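(* Let $K$ be a compact Hausdorff space, let $A$ be a uniform algebra on $K$, and let $\Gamma$ be the Shilov boundary of $A$. Then the following are equivalent: (i) $A$ has the polynomial Daugavet property. (ii) $A$ has the Daugavet property. (iii) $A$ has the DD2P. (iv) $A$ has the DLD2P. (v) $A$ has the property $(\mathcal{D})$. (vi) The Shilov boundary $\Gamma$ does not have isolated points.
   Context: A uniform algebra on $K$ is a closed subalgebra of $C(K)$ (complex-valued continuous functions with the supremum norm) that separates the points of $K$ and contains the constant functions. A subset $L\subset K$ is a boundary for $A$ if for every $f\in A$ there is $t\in L$ with $|f(t)|=\|f\|_\infty$; the Shilov boundary $\Gamma$ is the smallest closed boundary. Isolated points of $\Gamma$ are taken in the relative topology of $\Gamma$. For a Banach space $Z$ with closed unit ball $B_Z$, unit sphere $S_Z$ and identity $I$: a slice of $B_Z$ is a set $\{y\in B_Z : \mathrm{Re}\,z^*y>1-\epsilon\}$ with $z^*\in S_{Z^*}$, $\epsilon>0$. A polynomial $P:Z\to Z$ is a finite sum of bounded homogeneous polynomials $z\mapsto F(z,\dots,z)$ ($F:Z^k\to Z$ bounded $k$-linear), with $\|P\|=\sup_{z\in B_Z}\|Pz\|$; it is weakly compact if $P(B_Z)$ is relatively weakly compact. $Z$ has the polynomial Daugavet property if $\|I+P\|=1+\|P\|$ for every weakly compact polynomial $P:Z\to Z$. $Z$ has the Daugavet property if $\|I+T\|=1+\|T\|$ for every rank-one bounded linear operator $T:Z\to Z$. $Z$ has the diametral diameter two property (DD2P) if for every nonempty relatively weakly open $W\subset B_Z$,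 every $x\in W\cap S_Z$ and every $\epsilon>0$ there is $y\in W$ with $\|x-y\|\ge 2-\epsilon$. $Z$ has the diametral local diameter two property (DLD2P) if for every slice $S$ of $B_Z$, every $x\in S\cap S_Z$ and every $\epsilon>0$ there is $y\in S$ with $\|x-y\|\ge 2-\epsilon$. $Z$ has property $(\mathcal{D})$ if every rank-one, norm-one (linear) projection $P:Z\to Z$ satisfies $\|I-P\|=2$. *)

theory Defs
  imports "HOL-Analysis.Analysis"
begin

section \<open>Complex normed spaces\<close>

class complex_normed_vector = real_normed_vector +
  fixes scaleC :: "complex \<Rightarrow> 'a \<Rightarrow> 'a"  (infixr \<open>*\<^sub>C\<close> 75)
  assumes scaleC_add_right: "a *\<^sub>C (x + y) = a *\<^sub>C x + a *\<^sub>C y"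
    and scaleC_add_left: "(a + b) *\<^sub>C x = a *\<^sub>C x + b *\<^sub>C x"
    and scaleC_scaleC: "a *\<^sub>C b *\<^sub>C x = (a * b) *\<^sub>C x"
    and scaleC_of_real: "of_real r *\<^sub>C x = r *\<^sub>R x"
    and norm_scaleC: "norm (a *\<^sub>C x) = cmod a * norm x"

lemma scaleC_one: "1 *\<^sub>C x = (x :: 'a::complex_normed_vector)"
  using scaleC_of_real[of 1 x] by simp

global_interpretation complex_vector:
  vector_space "scaleC :: complex \<Rightarrow> 'a \<Rightarrow> 'a::complex_normed_vector"
  by unfold_locales (simp_all add: scaleC_add_right scaleC_add_left scaleC_scaleC scaleC_one)

instantiation complex :: complex_normed_vector
begin

definition scaleC_complex :: "complex \<Rightarrow> complex \<Rightarrow> complex"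
  where "scaleC_complex a x = a * x"

instance
  by standard (simp_all add: scaleC_complex_def algebra_simps norm_mult scaleR_conv_of_real)

end

lemma continuous_on_scaleC:
  fixes f :: "'a::topological_space \<Rightarrow> 'b::complex_normed_vector"
  assumes "continuous_on S f"
  shows "continuous_on S (\<lambda>t. c *\<^sub>C f t)"
proof -
  have "bounded_linear (\<lambda>x::'b. c *\<^sub>C x)"
  proof (rule bounded_linear_intro)
    show "c *\<^sub>C (x + y) = c *\<^sub>C x + c *\<^sub>C y" for x y :: 'b
      by (rule scaleC_add_right)
    show "c *\<^sub>C (r *\<^sub>R x) = r *\<^sub>R (c *\<^sub>C x)" for r and x :: 'b
      by (simp add: scaleC_scaleC mult.commute flip: scaleC_of_real)
    show "norm (c *\<^sub>C x) \<le> norm x * cmod c" for x :: 'b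
      by (simp add: norm_scaleC)
  qed
  then show ?thesis
    using assms by (rule bounded_linear.continuous_on)
qed

instantiation bcontfun :: (topological_space, complex_normed_vector) complex_normed_vector
begin

definition scaleC_bcontfun :: "complex \<Rightarrow> ('a \<Rightarrow>\<^sub>C 'b) \<Rightarrow> 'a \<Rightarrow>\<^sub>C 'b"
  where "scaleC_bcontfun c f = Bcontfun (\<lambda>t. c *\<^sub>C f t)"

lemma apply_scaleC_bcontfun: "apply_bcontfun (c *\<^sub>C f) t = c *\<^sub>C f t"
  for f :: "'a \<Rightarrow>\<^sub>C 'b"
proof -
  obtain B where B: "norm (f s) \<le> B" for s
    using norm_bounded by blast
  have "(\<lambda>t. c *\<^sub>C f t) \<in> bcontfun"
    unfolding bcontfun_def bounded_iff
    by (auto intro!: continuous_on_scaleC exI[of _ "cmod c * B"] mult_left_mono B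
        simp: norm_scaleC)
  then show ?thesis
    by (simp add: scaleC_bcontfun_def Bcontfun_inverse)
qed

instance
proof
  fix a b :: complex and r :: real and x y :: "'a \<Rightarrow>\<^sub>C 'b"
  show "a *\<^sub>C (x + y) = a *\<^sub>C x + a *\<^sub>C y"
    by (rule bcontfun_eqI) (simp add: apply_scaleC_bcontfun scaleC_add_right)
  show "(a + b) *\<^sub>C x = a *\<^sub>C x + b *\<^sub>C x"
    by (rule bcontfun_eqI) (simp add: apply_scaleC_bcontfun scaleC_add_left)
  show "a *\<^sub>C b *\<^sub>C x = (a * b) *\<^sub>C x"
    by (rule bcontfun_eqI) (simp add: apply_scaleC_bcontfun scaleC_scaleC)
  show "of_real r *\<^sub>C x = r *\<^sub>R x"
    by (rule bcontfun_eqI) (simp add: apply_scaleC_bcontfun scaleC_of_real)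
  have le: "norm (c *\<^sub>C z) \<le> cmod c * norm z" for c and z :: "'a \<Rightarrow>\<^sub>C 'b"
    by (rule norm_bound) (simp add: apply_scaleC_bcontfun norm_scaleC mult_left_mono norm_bounded)
  show "norm (a *\<^sub>C x) = cmod a * norm x"
  proof (cases "a = 0")
    case True
    then show ?thesis using le[of a x] by simp
  next
    case False
    have "inverse a *\<^sub>C a *\<^sub>C x = x"
      using False
      by (intro bcontfun_eqI) (simp add: apply_scaleC_bcontfun scaleC_scaleC scaleC_one)
    then have "norm x \<le> cmod (inverse a) * norm (a *\<^sub>C x)"
      using le[of "inverse a" "a *\<^sub>C x"] by simp
    then have "cmod a * norm x \<le> norm (a *\<^sub>C x)"
      using False by (simp add: norm_inverse norm_divide field_simps)
    then show ?thesis using le[of a x] by simp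
  qed
qed

end

section \<open>Banach spaces as closed subspaces\<close>

text \<open>
  A complex Banach space is represented by a closed complex subspace \<open>Z\<close> of a complete type of
  class \<^class>\<open>complex_normed_vector\<close>, with the inherited norm. Functions on \<open>Z\<close> are functions on
  the whole type of which only the values on \<open>Z\<close> matter; in particular, the dual is that of \<open>Z\<close>
  and not that of the ambient type.
\<close>

definition unit_ball :: "'a::complex_normed_vector set \<Rightarrow> 'a set"
  where "unit_ball Z = {z \<in> Z. norm z \<le> 1}"

definition unit_sphere :: "'a::complex_normed_vector set \<Rightarrow> 'a set"
  where "unit_sphere Z = {z \<in> Z. norm z = 1}"

text \<open>
  The supremum is only meaningful for functions bounded on the unit ball of \<open>Z\<close>, such as bounded
  linear maps, for which it is the operator norm, and polynomials.
\<close>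

definition ball_norm ::
  "'a::complex_normed_vector set \<Rightarrow> ('a \<Rightarrow> 'b::complex_normed_vector) \<Rightarrow> real"
  where "ball_norm Z P = (SUP z\<in>unit_ball Z. norm (P z))"

definition bounded_clinear_on ::
  "'a::complex_normed_vector set \<Rightarrow> ('a \<Rightarrow> 'b::complex_normed_vector) \<Rightarrow> bool"
  where "bounded_clinear_on Z T \<longleftrightarrow>
    (\<forall>x\<in>Z. \<forall>y\<in>Z. T (x + y) = T x + T y) \<and>
    (\<forall>c. \<forall>x\<in>Z. T (c *\<^sub>C x) = c *\<^sub>C T x) \<and>
    (\<exists>C. \<forall>x\<in>Z. norm (T x) \<le> C * norm x)"

definition dual :: "'a::complex_normed_vector set \<Rightarrow> ('a \<Rightarrow> complex) set"
  where "dual Z = {\<phi>. bounded_clinear_on Z \<phi>}"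

definition rank_one_operator ::
  "'a::complex_normed_vector set \<Rightarrow> ('a \<Rightarrow> 'a) \<Rightarrow> bool"
  where "rank_one_operator Z T \<longleftrightarrow>
    bounded_clinear_on Z T \<and> T ` Z \<subseteq> Z \<and> complex_vector.dim (T ` Z) = 1"

definition weak_topology :: "'a::complex_normed_vector set \<Rightarrow> 'a topology"
  where "weak_topology Z =
    topology_generated_by {{z \<in> Z. \<phi> z \<in> U} | \<phi> U. \<phi> \<in> dual Z \<and> open U}"

definition is_slice :: "'a::complex_normed_vector set \<Rightarrow> 'a set \<Rightarrow> bool"
  where "is_slice Z S \<longleftrightarrow>
    (\<exists>\<phi>\<in>dual Z. \<exists>\<epsilon>>0. ball_norm Z \<phi> = 1 \<and> S = {y \<in> unit_ball Z. Re (\<phi> y) > 1 - \<epsilon>})"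

section \<open>Polynomials\<close>

text \<open>Elements of \<open>Z\<^sup>k\<close> are lists over \<open>Z\<close> of length \<open>k\<close>. The case \<open>k = 0\<close> gives the constants.\<close>

definition bounded_multilinear_on ::
  "'a::complex_normed_vector set \<Rightarrow> nat \<Rightarrow> ('a list \<Rightarrow> 'a) \<Rightarrow> bool"
  where "bounded_multilinear_on Z k F \<longleftrightarrow>
    (\<forall>xs\<in>lists Z. length xs = k \<longrightarrow> F xs \<in> Z) \<and>
    (\<forall>xs\<in>lists Z. length xs = k \<longrightarrow> (\<forall>i<k.
      (\<forall>x\<in>Z. \<forall>y\<in>Z. F (xs[i := x + y]) = F (xs[i := x]) + F (xs[i := y])) \<and>
      (\<forall>c. \<forall>x\<in>Z. F (xs[i := c *\<^sub>C x]) = c *\<^sub>C F (xs[i := x])))) \<and>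
    (\<exists>C. \<forall>xs\<in>lists Z. length xs = k \<longrightarrow> norm (F xs) \<le> C * prod_list (map norm xs))"

definition homogeneous_polynomial_on ::
  "'a::complex_normed_vector set \<Rightarrow> ('a \<Rightarrow> 'a) \<Rightarrow> bool"
  where "homogeneous_polynomial_on Z Q \<longleftrightarrow>
    (\<exists>k F. bounded_multilinear_on Z k F \<and> (\<forall>z\<in>Z. Q z = F (replicate k z)))"

definition polynomial_on :: "'a::complex_normed_vector set \<Rightarrow> ('a \<Rightarrow> 'a) \<Rightarrow> bool"
  where "polynomial_on Z P \<longleftrightarrow>
    (\<exists>(n::nat) Q. (\<forall>i<n. homogeneous_polynomial_on Z (Q i)) \<and> (\<forall>z\<in>Z. P z = (\<Sum>i<n. Q i z)))"

definition weakly_compact_on :: "'a::complex_normed_vector set \<Rightarrow> ('a \<Rightarrow> 'a) \<Rightarrow> bool"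
  where "weakly_compact_on Z P \<longleftrightarrow>
    compactin (weak_topology Z) (weak_topology Z closure_of (P ` unit_ball Z))"

section \<open>Daugavet and diameter two properties\<close>

definition polynomial_daugavet_property :: "'a::complex_normed_vector set \<Rightarrow> bool"
  where "polynomial_daugavet_property Z \<longleftrightarrow>
    (\<forall>P. polynomial_on Z P \<and> weakly_compact_on Z P \<longrightarrow>
      ball_norm Z (\<lambda>z. z + P z) = 1 + ball_norm Z P)"

definition daugavet_property :: "'a::complex_normed_vector set \<Rightarrow> bool"
  where "daugavet_property Z \<longleftrightarrow>
    (\<forall>T. rank_one_operator Z T \<longrightarrow> ball_norm Z (\<lambda>z. z + T z) = 1 + ball_norm Z T)"

definition DD2P :: "'a::complex_normed_vector set \<Rightarrow> bool"
  where "DD2P Z \<longleftrightarrow>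
    (\<forall>W. openin (subtopology (weak_topology Z) (unit_ball Z)) W \<and> W \<noteq> {} \<longrightarrow>
      (\<forall>x \<in> W \<inter> unit_sphere Z. \<forall>\<epsilon>>0. \<exists>y\<in>W. norm (x - y) \<ge> 2 - \<epsilon>))"

definition DLD2P :: "'a::complex_normed_vector set \<Rightarrow> bool"
  where "DLD2P Z \<longleftrightarrow>
    (\<forall>S. is_slice Z S \<longrightarrow>
      (\<forall>x \<in> S \<inter> unit_sphere Z. \<forall>\<epsilon>>0. \<exists>y\<in>S. norm (x - y) \<ge> 2 - \<epsilon>))"

definition property_D :: "'a::complex_normed_vector set \<Rightarrow> bool"
  where "property_D Z \<longleftrightarrow>
    (\<forall>P. rank_one_operator Z P \<and> (\<forall>z\<in>Z. P (P z) = P z) \<and> ball_norm Z P = 1 \<longrightarrow>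
      ball_norm Z (\<lambda>z. z - P z) = 2)"

section \<open>Uniform algebras\<close>

text \<open>
  The underlying space \<open>K\<close> is the whole type \<open>'k\<close>. When it is compact, every continuous function
  is bounded and \<open>'k \<Rightarrow>\<^sub>C complex\<close> is \<open>C(K)\<close> with the supremum norm. There is no multiplication on
  this type in the library, hence the explicit pointwise product.
\<close>

definition mult_bcontfun ::
  "('k::topological_space \<Rightarrow>\<^sub>C complex) \<Rightarrow> ('k \<Rightarrow>\<^sub>C complex) \<Rightarrow> 'k \<Rightarrow>\<^sub>C complex"
  where "mult_bcontfun f g = Bcontfun (\<lambda>t. f t * g t)"

lemma apply_mult_bcontfun: "apply_bcontfun (mult_bcontfun f g) t = f t * g t"
proof -
  have "cmod (f s * g s) \<le> norm f * norm g" for s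
    by (simp add: norm_mult mult_mono norm_bounded)
  then have "(\<lambda>t. f t * g t) \<in> bcontfun"
    unfolding bcontfun_def bounded_iff by (auto intro!: continuous_intros)
  then show ?thesis
    by (simp add: mult_bcontfun_def Bcontfun_inverse)
qed

definition uniform_algebra :: "('k::topological_space \<Rightarrow>\<^sub>C complex) set \<Rightarrow> bool"
  where "uniform_algebra A \<longleftrightarrow>
    closed A \<and>
    complex_vector.subspace A \<and>
    (\<forall>f\<in>A. \<forall>g\<in>A. mult_bcontfun f g \<in> A) \<and>
    (\<forall>c. const_bcontfun c \<in> A) \<and>
    (\<forall>s t. s \<noteq> t \<longrightarrow> (\<exists>f\<in>A. apply_bcontfun f s \<noteq> apply_bcontfun f t))"

definition is_boundary :: "('k::topological_space \<Rightarrow>\<^sub>C complex) set \<Rightarrow> 'k set \<Rightarrow> bool"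
  where "is_boundary A L \<longleftrightarrow> (\<forall>f\<in>A. \<exists>t\<in>L. cmod (apply_bcontfun f t) = norm f)"

text \<open>The least element is taken with respect to inclusion.\<close>

definition shilov_boundary :: "('k::topological_space \<Rightarrow>\<^sub>C complex) set \<Rightarrow> 'k set"
  where "shilov_boundary A = (LEAST L. closed L \<and> is_boundary A L)"

end

theory Submission
  imports Defs
begin

text \<open>
  Five implications are easy: rank-one operators are weakly compact polynomials; the Daugavet property
  applied to \<open>-P\<close>, as well as the DLD2P applied to a slice around the range of \<open>P\<close>, gives \<open>(\<D>)\<close>; slices are
  weakly open; and an isolated point \<open>t\<close> of \<open>\<Gamma>\<close> carries some \<open>h \<in> A\<close> with \<open>h(t) = \<parallel>h\<parallel> = 1\<close> and
  \<open>\<bar>h\<bar> \<le> 1/2\<close> on the rest of \<open>\<Gamma>\<close>, so that \<open>f \<mapsto> f(t) h\<close> violates \<open>(\<D>)\<close>.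

  Now let \<open>\<Gamma>\<close> have no isolated points. Near any point of \<open>\<Gamma>\<close> there are infinitely many disjoint open
  sets meeting \<open>\<Gamma>\<close>, and on each of them \<open>s \<in> A\<close> with \<open>\<parallel>s\<parallel> < 1\<close> can be changed to take a prescribed value
  of modulus less than 1 without leaving the unit ball. The changes \<open>u\<^sub>k\<close> behave like the unit vectors of
  \<open>c\<^sub>0\<close>, so \<open>\<Phi>(s + u\<^sub>k) \<longlonglongrightarrow> \<Phi>(s)\<close> for every scalar polynomial \<open>\<Phi>\<close>. For linear \<open>\<Phi>\<close> this yields the
  DD2P. For a weakly compact polynomial \<open>P\<close>, iterating such changes produces elements \<open>P(s\<^sub>m)\<close> and points
  \<open>t\<^sub>n\<close> whose iterated limits would differ if \<open>\<parallel>I + P\<parallel> < 1 + \<parallel>P\<parallel>\<close>.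
\<close>

section \<open>Uniform algebras and boundaries\<close>

locale uniform_alg =
  fixes A :: "('k::t2_space \<Rightarrow>\<^sub>C complex) set"
  assumes compact_UNIV: "compact (UNIV :: 'k set)"
    and uniform_algebra: "uniform_algebra A"
begin

declare apply_scaleC_bcontfun [simp] apply_mult_bcontfun [simp] scaleC_complex_def [simp]

lemma subspace: "complex_vector.subspace A"
  using uniform_algebra by (simp add: uniform_algebra_def)

lemmas zero_mem = complex_vector.subspace_0[OF subspace]
  and add_mem = complex_vector.subspace_add[OF subspace]
  and diff_mem = complex_vector.subspace_diff[OF subspace]
  and uminus_mem = complex_vector.subspace_neg[OF subspace]
  and scaleC_mem = complex_vector.subspace_scale[OF subspace]
  and sum_mem = complex_vector.subspace_sum[OF subspace]

lemma mult_mem: "f \<in> A \<Longrightarrow> g \<in> A \<Longrightarrow> mult_bcontfun f g \<in> A"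
  using uniform_algebra by (simp add: uniform_algebra_def)

lemma const_mem: "const_bcontfun c \<in> A"
  using uniform_algebra by (simp add: uniform_algebra_def)

lemma power_mem:
  assumes "f \<in> A"
  obtains g where "g \<in> A" "\<And>t. apply_bcontfun g t = apply_bcontfun f t ^ n"
proof -
  have "\<exists>g\<in>A. \<forall>t. apply_bcontfun g t = apply_bcontfun f t ^ n"
  proof (induction n)
    case 0
    show ?case by (intro bexI[of _ "const_bcontfun 1"] const_mem) simp
  next
    case (Suc n)
    then obtain g where "g \<in> A" "\<forall>t. apply_bcontfun g t = apply_bcontfun f t ^ n" by blast
    then show ?case using assms by (intro bexI[of _ "mult_bcontfun f g"] mult_mem) auto
  qed
  then show thesis using that by blast
qed

section \<open>Compactness of K and maximum moduli\<close>

lemma closed_imp_compact: "closed (L :: 'k set) \<Longrightarrow> compact L"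
  using compact_UNIV by (metis compact_Int_closed Int_UNIV_left)

lemma norm_level_sets:
  fixes f :: "'k \<Rightarrow>\<^sub>C complex"
  shows "open {t. cmod (f t) < c}" "open {t. cmod (f t) > c}" "closed {t. cmod (f t) = c}"
    "closed {t. cmod (f t - a) \<ge> c}" "open {t. cmod (f t - a) < c}"
  by (auto intro!: open_Collect_less closed_Collect_eq closed_Collect_le continuous_intros)

text \<open>By compactness the modulus attains its maximum on \<open>L\<close>, which turns a
  pointwise strict bound into a uniform one.\<close>

lemma bounded_away_from_1:
  fixes f :: "'k \<Rightarrow>\<^sub>C complex"
  assumes "closed L" "\<And>t. t \<in> L \<Longrightarrow> cmod (f t) < 1"
  obtains r where "0 \<le> r" "r < 1" "\<And>t. t \<in> L \<Longrightarrow> cmod (f t) \<le> r"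
proof (cases "L = {}")
  case True
  then show thesis using that[of 0] by simp
next
  case False
  have "continuous_on L (\<lambda>t. cmod (f t))" by (intro continuous_intros continuous_on_apply_bcontfun)
  then obtain t where "t \<in> L" "\<And>s. s \<in> L \<Longrightarrow> cmod (f s) \<le> cmod (f t)"
    using continuous_attains_sup[OF closed_imp_compact[OF assms(1)] False] by blast
  then show thesis using that[of "cmod (f t)"] assms(2) by simp
qed

lemma norm_le_if_boundary:
  assumes "is_boundary A L" "f \<in> A" "\<And>t. t \<in> L \<Longrightarrow> cmod (apply_bcontfun f t) \<le> c"
  shows "norm f \<le> c"
  using assms unfolding is_boundary_def by metis

text \<open>The inequality stays strict because the norm is attained at a point of
  \<open>L\<close>.\<close>

lemma norm_less_if_boundary:
  assumes "is_boundary A L" "f \<in> A" "\<And>t. t \<in> L \<Longrightarrow> cmod (apply_bcontfun f t) < c"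
  shows "norm f < c"
  using assms unfolding is_boundary_def by metis

lemma is_boundary_UNIV: "is_boundary A UNIV"
  unfolding is_boundary_def
proof
  fix f :: "'k \<Rightarrow>\<^sub>C complex"
  have "continuous_on UNIV (\<lambda>t. cmod (f t))" by (intro continuous_intros continuous_on_apply_bcontfun)
  then obtain t where "\<And>s. cmod (f s) \<le> cmod (f t)"
    using continuous_attains_sup[OF compact_UNIV] by blast
  then have "norm f \<le> cmod (f t)" by (rule norm_bound)
  then show "\<exists>t\<in>UNIV. cmod (f t) = norm f" using norm_bounded[of f t] by (auto intro: antisym)
qed

text \<open>A function missing its norm on \<open>L\<close> is divided by its norm, which is
  positive because it exceeds the modulus at a point of \<open>L\<close>. For empty \<open>L\<close>
  that function could be 0, so the constant 1 is taken instead.\<close>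

lemma not_boundary_witness:
  assumes "\<not> is_boundary A L"
  obtains f where "f \<in> A" "norm f = 1" "\<And>t. t \<in> L \<Longrightarrow> cmod (apply_bcontfun f t) < 1"
proof (cases "L = {}")
  case True
  have "norm (const_bcontfun 1 :: 'k \<Rightarrow>\<^sub>C complex) = 1"
  proof (rule antisym)
    show "norm (const_bcontfun 1 :: 'k \<Rightarrow>\<^sub>C complex) \<le> 1" by (rule norm_bound) simp
    show "1 \<le> norm (const_bcontfun 1 :: 'k \<Rightarrow>\<^sub>C complex)"
      using norm_bounded[of "const_bcontfun 1 :: 'k \<Rightarrow>\<^sub>C complex" undefined] by simp
  qed
  then show thesis using that[OF const_mem[of 1]] True by simp
next
  case False
  from assms obtain f where f: "f \<in> A" "\<And>t. t \<in> L \<Longrightarrow> cmod (apply_bcontfun f t) \<noteq> norm f"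
    unfolding is_boundary_def by blast
  have lt: "cmod (apply_bcontfun f t) < norm f" if "t \<in> L" for t
    using f(2)[OF that] norm_bounded[of f t] by simp
  then have pos: "norm f > 0" using False by (metis ex_in_conv norm_ge_zero le_less_trans)
  show thesis
  proof (rule that)
    show "complex_of_real (1 / norm f) *\<^sub>C f \<in> A" using f(1) by (rule scaleC_mem)
    show "norm (complex_of_real (1 / norm f) *\<^sub>C f) = 1" using pos by (simp add: norm_scaleC norm_divide)
    show "cmod (apply_bcontfun (complex_of_real (1 / norm f) *\<^sub>C f) t) < 1" if "t \<in> L" for t
      using lt[OF that] pos by (simp add: norm_mult norm_divide)
  qed
qed

section \<open>The Shilov boundary\<close>

text \<open>With finite \<open>F\<close> contained in \<open>A\<close> these sets form a basis of
  the topology of K. Being cut out by members of \<open>A\<close>, they can be handled by estimating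
  products inside \<open>A\<close>.\<close>

definition poly_nbhd :: "('k \<Rightarrow>\<^sub>C complex) set \<Rightarrow> 'k set"
  where "poly_nbhd F = {t. \<forall>f\<in>F. cmod (apply_bcontfun f t) < 1}"

lemma open_poly_nbhd: "finite F \<Longrightarrow> open (poly_nbhd F)"
proof -
  assume "finite F"
  moreover have "poly_nbhd F = (\<Inter>f\<in>F. {t. cmod (apply_bcontfun f t) < 1})"
    by (auto simp: poly_nbhd_def)
  ultimately show ?thesis by (simp add: open_INT norm_level_sets)
qed

text \<open>Every \<open>s\<close> outside \<open>U\<close> is separated from \<open>t\<close> by
  some member of \<open>A\<close>, normalised to be 0 at \<open>t\<close> and 2 at \<open>s\<close>.
  Since \<open>- U\<close> is compact, finitely many of the sets where such functions exceed 1 in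
  modulus cover it.\<close>

lemma poly_nbhd_basis:
  assumes "open U" "t \<in> U"
  obtains F where "finite F" "F \<subseteq> A" "t \<in> poly_nbhd F" "poly_nbhd F \<subseteq> U"
proof -
  let ?C = "{f \<in> A. apply_bcontfun f t = 0}"
  have cover: "- U \<subseteq> (\<Union>f\<in>?C. {s. cmod (apply_bcontfun f s) > 1})"
  proof
    fix s assume "s \<in> - U"
    then have "s \<noteq> t" using assms by auto
    then obtain g where g: "g \<in> A" "apply_bcontfun g s \<noteq> apply_bcontfun g t"
      using uniform_algebra unfolding uniform_algebra_def by blast
    let ?f = "(2 / (g s - g t)) *\<^sub>C (g - const_bcontfun (g t))"
    have "?f \<in> ?C" using g by (auto intro: scaleC_mem diff_mem const_mem)
    moreover have "apply_bcontfun ?f s = 2"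
      using g by (simp add: divide_simps del: mult_2 left_diff_distrib_numeral right_diff_distrib_numeral)
    ultimately have "?f \<in> ?C" "cmod (apply_bcontfun ?f s) > 1" by simp_all
    then show "s \<in> (\<Union>f\<in>?C. {s. cmod (apply_bcontfun f s) > 1})" by blast
  qed
  have "compact (- U)" using assms by (intro closed_imp_compact) (simp add: closed_Compl)
  then obtain F where F: "F \<subseteq> ?C" "finite F" "- U \<subseteq> (\<Union>f\<in>F. {s. cmod (apply_bcontfun f s) > 1})"
    by (rule compactE_image[OF _ norm_level_sets(2) cover])
  have "s \<in> U" if "s \<in> poly_nbhd F" for s
    using F(3) that unfolding poly_nbhd_def by fastforce
  then show thesis using F by (intro that[of F]) (auto simp: poly_nbhd_def)
qed

text \<open>
  If a function \<open>g\<close> of norm 1 had modulus below 1 on \<open>L\<close> minus the neighbourhood, then so would \<open>g\<^sup>n f\<close>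
  on all of \<open>L\<close> for \<open>f \<in> F\<close> and large \<open>n\<close>; hence \<open>g\<close> could only attain its norm in the neighbourhood.
\<close>

lemma is_boundary_diff_poly_nbhd:
  assumes F: "finite F" "F \<subseteq> A" and L: "closed L" "is_boundary A L"
    and L': "is_boundary A L'" "poly_nbhd F \<inter> L' = {}"
  shows "is_boundary A (L - poly_nbhd F)"
proof (rule ccontr)
  assume "\<not> ?thesis"
  then obtain g where g: "g \<in> A" "norm g = 1"
    "\<And>t. t \<in> L - poly_nbhd F \<Longrightarrow> cmod (apply_bcontfun g t) < 1"
    by (rule not_boundary_witness) blast
  have "closed (L - poly_nbhd F)" using L F by (intro closed_Diff open_poly_nbhd)
  then obtain r where r: "0 \<le> r" "r < 1" "\<And>t. t \<in> L - poly_nbhd F \<Longrightarrow> cmod (apply_bcontfun g t) \<le> r"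
    using bounded_away_from_1 g(3) by metis
  obtain t where t: "t \<in> L'" "cmod (apply_bcontfun g t) = 1"
    using L' g unfolding is_boundary_def by metis
  have "cmod (apply_bcontfun f t) < 1" if "f \<in> F" for f
  proof -
    obtain n where n: "r ^ n * norm f < 1"
    proof -
      have "(\<lambda>n. r ^ n * norm f) \<longlonglongrightarrow> 0"
        using r by (intro tendsto_mult_left_zero LIMSEQ_realpow_zero)
      then have "\<forall>\<^sub>F n in sequentially. r ^ n * norm f < 1" by (rule order_tendstoD) simp
      then show thesis using that by (auto simp: eventually_sequentially)
    qed
    obtain p where p: "p \<in> A" "\<And>t. apply_bcontfun p t = apply_bcontfun g t ^ n"
      using power_mem[OF g(1)] by blast
    have "norm (mult_bcontfun p f) < 1"
    proof (rule norm_less_if_boundary[OF L(2)])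
      show "mult_bcontfun p f \<in> A" using F p that by (intro mult_mem) auto
      fix s assume s: "s \<in> L"
      show "cmod (apply_bcontfun (mult_bcontfun p f) s) < 1"
      proof (cases "s \<in> poly_nbhd F")
        case True
        then have "cmod (apply_bcontfun f s) < 1" using that by (auto simp: poly_nbhd_def)
        moreover have "cmod (apply_bcontfun g s) ^ n \<le> 1"
          using norm_bounded[of g s] g by (intro power_le_one) auto
        ultimately show ?thesis
          by (simp add: p norm_mult norm_power)
            (meson le_less_trans mult_left_le_one_le norm_ge_zero zero_le_power)
      next
        case False
        then have "cmod (apply_bcontfun g s) ^ n \<le> r ^ n"
          using r s by (intro power_mono) auto
        then have "cmod (apply_bcontfun g s) ^ n * cmod (apply_bcontfun f s) \<le> r ^ n * norm f"
          by (intro mult_mono norm_bounded) (use r in auto)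
        then show ?thesis using n by (simp add: p norm_mult norm_power)
      qed
    qed
    \<comment> \<open>At \<open>t\<close> the factor \<open>p\<close> has modulus 1, so the bound on
      the product is a bound on \<open>f\<close>.\<close>
    moreover have "cmod (apply_bcontfun (mult_bcontfun p f) t) = cmod (apply_bcontfun f t)"
      using t by (simp add: p norm_mult norm_power)
    ultimately show ?thesis using norm_bounded[of "mult_bcontfun p f" t] by linarith
  qed
  then show False using t L' by (auto simp: poly_nbhd_def)
qed

text \<open>The intersection lies in every closed boundary by construction; the substantial part of
  identifying it with the \<open>LEAST\<close> in \<open>shilov_boundary\<close> is that it is a
  boundary itself.\<close>

definition shilov :: "'k set" where "shilov = \<Inter>{L. closed L \<and> is_boundary A L}"

lemma closed_shilov: "closed shilov"
  unfolding shilov_def by (rule closed_Inter) simp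

lemma shilov_minimal: "closed L \<Longrightarrow> is_boundary A L \<Longrightarrow> shilov \<subseteq> L"
  unfolding shilov_def by (rule Inter_lower) simp

text \<open>If \<open>f\<close> missed its norm on the intersection, the compact set where its
  modulus equals its norm would be covered by finitely many basic neighbourhoods, each disjoint from
  some boundary. By \<open>is_boundary_diff_poly_nbhd\<close> these can be removed from the whole
  space one after another, which leaves a boundary on which \<open>f\<close> does not attain its
  norm.\<close>

lemma is_boundary_shilov: "is_boundary A shilov"
  unfolding is_boundary_def
proof (rule ballI, rule ccontr)
  fix f assume f: "f \<in> A" and no: "\<not> (\<exists>t\<in>shilov. cmod (apply_bcontfun f t) = norm f)"
  let ?M = "{t. cmod (apply_bcontfun f t) = norm f}"
  let ?C = "{F. finite F \<and> F \<subseteq> A \<and> (\<exists>L'. is_boundary A L' \<and> poly_nbhd F \<inter> L' = {})}"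
  have cover: "?M \<subseteq> (\<Union>F\<in>?C. poly_nbhd F)"
  proof
    fix t assume "t \<in> ?M"
    then obtain L' where L': "closed L'" "is_boundary A L'" "t \<notin> L'"
      using no unfolding shilov_def by auto
    then obtain F where "finite F" "F \<subseteq> A" "t \<in> poly_nbhd F" "poly_nbhd F \<subseteq> - L'"
      using poly_nbhd_basis[of "- L'" t] by auto
    then show "t \<in> (\<Union>F\<in>?C. poly_nbhd F)" using L' by blast
  qed
  have op: "open (poly_nbhd F)" if "F \<in> ?C" for F using that by (simp add: open_poly_nbhd)
  have "compact ?M" by (intro closed_imp_compact norm_level_sets)
  then obtain D where D: "D \<subseteq> ?C" "finite D" "?M \<subseteq> (\<Union>F\<in>D. poly_nbhd F)"
    by (rule compactE_image[OF _ op cover])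
  have "closed (UNIV - (\<Union>F\<in>D. poly_nbhd F)) \<and> is_boundary A (UNIV - (\<Union>F\<in>D. poly_nbhd F))"
    using D(2,1)
  proof (induction D rule: finite_induct)
    case empty
    then show ?case by (simp add: is_boundary_UNIV)
  next
    case (insert F D)
    have eq: "UNIV - (\<Union>F\<in>insert F D. poly_nbhd F) = (UNIV - (\<Union>F\<in>D. poly_nbhd F)) - poly_nbhd F"
      by auto
    obtain L' where F: "finite F" "F \<subseteq> A" "is_boundary A L'" "poly_nbhd F \<inter> L' = {}"
      using insert.prems by auto
    have L: "closed (UNIV - (\<Union>F\<in>D. poly_nbhd F))" "is_boundary A (UNIV - (\<Union>F\<in>D. poly_nbhd F))"
      using insert.IH insert.prems by simp_all
    show ?case unfolding eq
      by (intro conjI closed_Diff[OF L(1) open_poly_nbhd[OF F(1)]]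
          is_boundary_diff_poly_nbhd[OF F(1,2) L F(3,4)])
  qed
  then obtain t where "t \<notin> (\<Union>F\<in>D. poly_nbhd F)" "cmod (apply_bcontfun f t) = norm f"
    using f unfolding is_boundary_def by blast
  then show False using D(3) by auto
qed

lemma shilov_boundary_eq: "shilov_boundary A = shilov"
  unfolding shilov_boundary_def
  by (rule Least_equality) (auto simp: closed_shilov is_boundary_shilov shilov_minimal)

lemmas norm_le_shilov = norm_le_if_boundary[OF is_boundary_shilov]

text \<open>By minimality \<open>shilov - U\<close> is not a boundary. A witness of norm 1 attains
  its norm on \<open>shilov\<close>, necessarily inside \<open>U\<close>; dividing by its value
  there gives the value 1.\<close>

lemma peak_modulus:
  assumes "open U" "U \<inter> shilov \<noteq> {}"
  obtains f t where "f \<in> A" "t \<in> U \<inter> shilov" "norm f = 1" "apply_bcontfun f t = 1"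
    "\<And>s. s \<in> shilov - U \<Longrightarrow> cmod (apply_bcontfun f s) < 1"
proof -
  have "closed (shilov - U)" using assms closed_shilov by blast
  then have "\<not> is_boundary A (shilov - U)" using assms shilov_minimal by blast
  then obtain g where g: "g \<in> A" "norm g = 1" "\<And>s. s \<in> shilov - U \<Longrightarrow> cmod (apply_bcontfun g s) < 1"
    by (rule not_boundary_witness) blast
  obtain t where t: "t \<in> shilov" "cmod (apply_bcontfun g t) = 1"
    using g is_boundary_shilov unfolding is_boundary_def by metis
  have nz: "g t \<noteq> 0" using t by auto
  have tU: "t \<in> U" using g(3)[of t] t by auto
  show thesis
  proof (rule that)
    show "(1 / g t) *\<^sub>C g \<in> A" using g by (intro scaleC_mem)
    show "t \<in> U \<inter> shilov" using tU t by simp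
    show "norm ((1 / g t) *\<^sub>C g) = 1" using t g by (simp add: norm_scaleC norm_divide)
    show "apply_bcontfun ((1 / g t) *\<^sub>C g) t = 1" using nz by simp
    show "cmod (apply_bcontfun ((1 / g t) *\<^sub>C g) s) < 1" if "s \<in> shilov - U" for s
      using g(3)[OF that] t by (simp add: norm_mult norm_divide)
  qed
qed

end

section \<open>Peak functions\<close>

text \<open>Equality case of the triangle inequality for 1 and a point of the closed unit
  disc.\<close>

lemma cmod_eq_2D:
  assumes "cmod z \<le> 1" "cmod (1 + z) = 2"
  shows "z = 1"
proof -
  have a: "(Re z)\<^sup>2 + (Im z)\<^sup>2 \<le> 1"
    using assms(1) by (metis cmod_power2 norm_ge_zero one_power2 power_mono)
  have "(1 + Re z)\<^sup>2 + (Im z)\<^sup>2 = 4"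
    using assms(2) cmod_power2[of "1 + z"] by simp
  then have "Re z \<ge> 1" using a by (simp add: power2_eq_square algebra_simps)
  then have "(Re z)\<^sup>2 \<ge> 1" by simp
  then have "Im z = 0" "(Re z)\<^sup>2 \<le> 1" using a zero_le_power2[of "Im z"] by (smt (verit) zero_less_power2)+
  then have "Re z = 1" using \<open>Re z \<ge> 1\<close> abs_square_le_1[of "Re z"] by simp
  then show ?thesis using \<open>Im z = 0\<close> by (simp add: complex_eq_iff)
qed

text \<open>The exponent is a successor so that powers with it are dominated by the base on
  [0, 1].\<close>

lemma ex_power_less:
  fixes r e :: real
  assumes "0 \<le> r" "r < 1" "0 < e"
  obtains n where "r ^ Suc n < e"
proof -
  have "\<forall>\<^sub>F n in sequentially. r ^ n < e"
    using assms by (intro order_tendstoD[OF LIMSEQ_realpow_zero])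
  then obtain N where N: "\<And>n. n \<ge> N \<Longrightarrow> r ^ n < e" by (auto simp: eventually_sequentially)
  show thesis by (rule that[OF N[of "Suc N"]]) simp
qed

context uniform_alg
begin

text \<open>For \<open>f\<close> from \<open>peak_modulus\<close>, the average (1 + f) / 2 has
  modulus 1 only where \<open>f\<close> equals 1, which excludes other unimodular values. A high
  power then makes it small on \<open>shilov - U\<close>.\<close>

lemma peak_point:
  assumes "open U" "U \<inter> shilov \<noteq> {}" "0 < e"
  obtains h t where "h \<in> A" "t \<in> U \<inter> shilov" "norm h \<le> 1" "apply_bcontfun h t = 1"
    "\<And>s. s \<in> shilov - U \<Longrightarrow> cmod (apply_bcontfun h s) \<le> e"
    "\<And>s. cmod (apply_bcontfun h s) \<ge> 1 \<Longrightarrow> apply_bcontfun h s = 1"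
proof -
  obtain f t where f: "f \<in> A" "t \<in> U \<inter> shilov" "norm f = 1" "apply_bcontfun f t = 1"
    "\<And>s. s \<in> shilov - U \<Longrightarrow> cmod (apply_bcontfun f s) < 1"
    using peak_modulus[OF assms(1,2)] by metis
  have le: "cmod (apply_bcontfun f s) \<le> 1" for s using norm_bounded[of f s] f by simp
  obtain r where r: "0 \<le> r" "r < 1" "\<And>s. s \<in> shilov - U \<Longrightarrow> cmod (apply_bcontfun f s) \<le> r"
    using bounded_away_from_1[OF _ f(5)] closed_shilov assms(1) by (metis closed_Diff)
  \<comment> \<open>On \<open>shilov - U\<close> the average \<open>g\<close> is bounded by (1 + r)
    / 2.\<close>
  obtain n where n: "((1 + r) / 2) ^ Suc n < e"
    using ex_power_less[of "(1 + r) / 2" e] r assms by auto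
  define g where "g = (1/2) *\<^sub>C (const_bcontfun 1 + f)"
  have g: "g \<in> A" unfolding g_def using f by (intro scaleC_mem add_mem const_mem)
  have gv: "apply_bcontfun g s = (1 + apply_bcontfun f s) / 2" for s by (simp add: g_def)
  obtain h where h: "h \<in> A" "\<And>s. apply_bcontfun h s = apply_bcontfun g s ^ Suc n"
    using power_mem[OF g] by blast
  have g1: "cmod (apply_bcontfun g s) \<le> (1 + cmod (apply_bcontfun f s)) / 2" for s
    using norm_triangle_ineq[of 1 "apply_bcontfun f s"] by (simp add: gv norm_divide)
  have g2: "cmod (apply_bcontfun g s) \<le> 1" for s using g1[of s] le[of s] by simp
  show thesis
  proof (rule that)
    show "h \<in> A" "t \<in> U \<inter> shilov" by fact+
    show "norm h \<le> 1"
      by (rule norm_bound) (use g2 in \<open>simp add: h norm_mult norm_power mult_le_one power_le_one\<close>)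
    show "apply_bcontfun h t = 1" using f by (simp add: h gv)
    show "cmod (apply_bcontfun h s) \<le> e" if "s \<in> shilov - U" for s
    proof -
      have "cmod (apply_bcontfun g s) \<le> (1 + r) / 2" using g1[of s] r(3)[OF that] by simp
      then have "cmod (apply_bcontfun h s) \<le> ((1 + r) / 2) ^ Suc n"
        unfolding h norm_power by (intro power_mono) auto
      then show ?thesis using n by simp
    qed
    show "apply_bcontfun h s = 1" if "cmod (apply_bcontfun h s) \<ge> 1" for s
    proof -
      have "cmod (apply_bcontfun g s) \<ge> 1"
      proof -
        have "cmod (apply_bcontfun g s) ^ Suc n \<le> cmod (apply_bcontfun g s)"
          using g2[of s] by (simp add: mult_left_le power_le_one)
        then show ?thesis using that unfolding h norm_power by linarith
      qed
      then have "cmod (1 + apply_bcontfun f s) = 2"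
        using g2[of s] by (simp add: gv norm_divide)
      then have "apply_bcontfun f s = 1" using cmod_eq_2D[OF le] by blast
      then show ?thesis by (simp add: h gv)
    qed
  qed
qed

text \<open>
  The sum consists of powers of \<open>h\<close> with rapidly growing exponents, so that at every point all summands
  but one are close to 0 or 1.
\<close>

lemma sum_of_powers_near_interval:
  assumes h: "h \<in> A" "norm h \<le> 1" "\<And>s. cmod (apply_bcontfun h s) \<ge> 1 \<Longrightarrow> apply_bcontfun h s = 1"
    and d: "0 < d"
  shows "\<exists>G\<in>A. (\<forall>s. apply_bcontfun h s = 1 \<longrightarrow> apply_bcontfun G s = of_nat N) \<and>
    (\<forall>s. cmod (apply_bcontfun G s) \<le> real N * cmod (apply_bcontfun h s)) \<and>
    (\<forall>s. \<exists>r\<in>{0..real N}. cmod (apply_bcontfun G s - of_real r) \<le> 1 + real N * d)"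
proof (induction N)
  case 0
  show ?case by (intro bexI[of _ 0]) (simp_all add: zero_mem)
next
  case (Suc N)
  then obtain G where G: "G \<in> A"
    "\<And>s. apply_bcontfun h s = 1 \<Longrightarrow> apply_bcontfun G s = of_nat N"
    "\<And>s. cmod (apply_bcontfun G s) \<le> real N * cmod (apply_bcontfun h s)"
    "\<And>s. \<exists>r\<in>{0..real N}. cmod (apply_bcontfun G s - of_real r) \<le> 1 + real N * d"
    by blast
  have h1: "cmod (apply_bcontfun h s) \<le> 1" for s using norm_bounded[of h s] h by simp
  \<comment> \<open>\<open>?L\<close> is where \<open>G\<close> is not yet within \<open>d\<close>
    of its final value \<open>N\<close>. There \<open>h\<close> has modulus below 1, so a high power
    of it adds at most \<open>d\<close>; elsewhere \<open>G\<close> is near \<open>N\<close> and the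
    new power adds at most 1. Hence the error 1 is paid once and \<open>d\<close> at each
    stage.\<close>
  let ?L = "{s. d \<le> cmod (apply_bcontfun G s - of_nat N)}"
  have "cmod (apply_bcontfun h s) < 1" if "s \<in> ?L" for s
    using that h(3)[of s] G(2)[of s] d by (cases "cmod (apply_bcontfun h s) < 1") auto
  then obtain r where r: "0 \<le> r" "r < 1" "\<And>s. s \<in> ?L \<Longrightarrow> cmod (apply_bcontfun h s) \<le> r"
    using bounded_away_from_1[OF norm_level_sets(4)] by metis
  obtain m where m: "r ^ Suc m < d" using ex_power_less[OF r(1,2) d] by blast
  obtain p where p: "p \<in> A" "\<And>s. apply_bcontfun p s = apply_bcontfun h s ^ Suc m"
    using power_mem[OF h(1)] by blast
  have ph: "cmod (apply_bcontfun p s) \<le> cmod (apply_bcontfun h s)" for s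
    unfolding p norm_power using h1[of s] by (simp add: mult_left_le power_le_one)
  show ?case
  proof (intro bexI[of _ "G + p"] conjI allI impI)
    show "G + p \<in> A" using G p by (intro add_mem)
    show "apply_bcontfun (G + p) s = of_nat (Suc N)" if "apply_bcontfun h s = 1" for s
      using G(2)[OF that] that by (simp add: p)
    show "cmod (apply_bcontfun (G + p) s) \<le> real (Suc N) * cmod (apply_bcontfun h s)" for s
      using norm_triangle_ineq[of "apply_bcontfun G s" "apply_bcontfun p s"] G(3)[of s] ph[of s]
      by (simp add: algebra_simps)
    show "\<exists>r\<in>{0..real (Suc N)}. cmod (apply_bcontfun (G + p) s - of_real r) \<le> 1 + real (Suc N) * d" for s
    proof (cases "s \<in> ?L")
      case True
      then have "cmod (apply_bcontfun p s) \<le> r ^ Suc m"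
        unfolding p norm_power by (intro power_mono r) auto
      moreover obtain r' where "r' \<in> {0..real N}" "cmod (apply_bcontfun G s - of_real r') \<le> 1 + real N * d"
        using G(4) by blast
      ultimately show ?thesis
        using norm_triangle_ineq[of "apply_bcontfun G s - of_real r'" "apply_bcontfun p s"] m
        by (intro bexI[of _ r']) (auto simp: algebra_simps)
    next
      case False
      have "real N * d \<ge> 0" using d by simp
      then show ?thesis
        using norm_triangle_ineq[of "apply_bcontfun G s - of_nat N" "apply_bcontfun p s"] False
          ph[of s] h1[of s]
        by (intro bexI[of _ "real N"]) (auto simp: algebra_simps)
    qed
  qed
qed

text \<open>Taking \<open>d = 1 / N\<close> and dividing the sum of powers by \<open>N\<close> turns
  the error 1 + N d = 2 into 2 / N, below \<open>e\<close> for large \<open>N\<close>. Values near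
  [0, 1] let \<open>spike\<close> form approximate convex combinations.\<close>

lemma peak_near_interval:
  assumes "open U" "U \<inter> shilov \<noteq> {}" "0 < e"
  obtains g t where "g \<in> A" "t \<in> U \<inter> shilov" "apply_bcontfun g t = 1"
    "\<And>s. s \<in> shilov - U \<Longrightarrow> cmod (apply_bcontfun g s) \<le> e"
    "\<And>s. \<exists>r\<in>{0..1}. cmod (apply_bcontfun g s - of_real r) \<le> e"
proof -
  obtain h t where h: "h \<in> A" "t \<in> U \<inter> shilov" "norm h \<le> 1" "apply_bcontfun h t = 1"
    "\<And>s. s \<in> shilov - U \<Longrightarrow> cmod (apply_bcontfun h s) \<le> e"
    "\<And>s. cmod (apply_bcontfun h s) \<ge> 1 \<Longrightarrow> apply_bcontfun h s = 1"
    using peak_point[OF assms] by metis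
  obtain N :: nat where N: "real N > 2 / e" using reals_Archimedean2 by blast
  have N0: "real N > 0" using N assms by (meson divide_pos_pos less_trans zero_less_numeral)
  obtain G where G: "G \<in> A"
    "\<And>s. apply_bcontfun h s = 1 \<Longrightarrow> apply_bcontfun G s = of_nat N"
    "\<And>s. cmod (apply_bcontfun G s) \<le> real N * cmod (apply_bcontfun h s)"
    "\<And>s. \<exists>r\<in>{0..real N}. cmod (apply_bcontfun G s - of_real r) \<le> 1 + real N * (1 / real N)"
    using sum_of_powers_near_interval[OF h(1,3,6), of "1 / real N" N] N0 by auto
  show thesis
  proof (rule that)
    show "(1 / of_nat N) *\<^sub>C G \<in> A" using G by (intro scaleC_mem)
    show "t \<in> U \<inter> shilov" by fact
    show "apply_bcontfun ((1 / of_nat N) *\<^sub>C G) t = 1" using G(2)[OF h(4)] N0 by simp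
    show "cmod (apply_bcontfun ((1 / of_nat N) *\<^sub>C G) s) \<le> e" if "s \<in> shilov - U" for s
    proof -
      have "cmod (apply_bcontfun G s) \<le> real N * e"
        using G(3)[of s] mult_left_mono[OF h(5)[OF that], of "real N"] by simp
      then show ?thesis using N0 by (simp add: norm_mult norm_divide field_simps)
    qed
    show "\<exists>r\<in>{0..1}. cmod (apply_bcontfun ((1 / of_nat N) *\<^sub>C G) s - of_real r) \<le> e" for s
    proof -
      obtain r where r: "r \<in> {0..real N}" "cmod (apply_bcontfun G s - of_real r) \<le> 2"
        using G(4)[of s] N0 by auto
      have "apply_bcontfun ((1 / of_nat N) *\<^sub>C G) s - of_real (r / N) = (apply_bcontfun G s - of_real r) / of_nat N"
        by (simp add: diff_divide_distrib)
      then have "cmod (apply_bcontfun ((1 / of_nat N) *\<^sub>C G) s - of_real (r / N)) \<le> 2 / N"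
        using r N0 by (simp add: norm_divide divide_right_mono)
      also have "\<dots> \<le> e" using N N0 assms by (simp add: field_simps)
      finally show ?thesis using r N0 by (intro bexI[of _ "r / N"]) auto
    qed
  qed
qed

end

section \<open>Polynomial functions along complex lines\<close>

text \<open>Records two features of scalar polynomials: along complex lines they have degree at most
  a common \<open>d\<close>, and they are bounded on bounded sets. Bounded functionals and point
  values of polynomials share both.\<close>

definition scalar_polynomial_on :: "'a::complex_normed_vector set \<Rightarrow> ('a \<Rightarrow> complex) \<Rightarrow> bool"
  where "scalar_polynomial_on Z \<Phi> \<longleftrightarrow>
    (\<exists>d. \<forall>x\<in>Z. \<forall>u\<in>Z. \<exists>c. \<forall>l. \<Phi> (x + l *\<^sub>C u) = (\<Sum>i\<le>d. c i * l ^ i)) \<and>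
    (\<forall>R. \<exists>B. \<forall>x\<in>Z. norm x \<le> R \<longrightarrow> cmod (\<Phi> x) \<le> B)"

text \<open>The second moment is the squared mean plus the variance; this plays the role of the
  orthogonality of martingale increments.\<close>

lemma sum_square_deviation:
  fixes z :: "nat \<Rightarrow> complex"
  assumes "(\<Sum>j<n. z j) = of_nat n * m"
  shows "(\<Sum>j<n. (cmod (z j))\<^sup>2) = real n * (cmod m)\<^sup>2 + (\<Sum>j<n. (cmod (z j - m))\<^sup>2)"
proof -
  have "(cmod (z j - m))\<^sup>2 = (cmod (z j))\<^sup>2 - 2 * Re (z j * cnj m) + (cmod m)\<^sup>2" for j
    unfolding cmod_power2 by (simp add: power2_eq_square algebra_simps)
  then have "(\<Sum>j<n. (cmod (z j - m))\<^sup>2) =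
      (\<Sum>j<n. (cmod (z j))\<^sup>2) - 2 * Re ((\<Sum>j<n. z j) * cnj m) + real n * (cmod m)\<^sup>2"
    by (simp add: sum.distrib sum_subtractf sum_distrib_left sum_distrib_right Re_sum)
  also have "Re ((\<Sum>j<n. z j) * cnj m) = real n * (cmod m)\<^sup>2"
    unfolding assms cmod_power2 by (simp add: power2_eq_square algebra_simps)
  finally show ?thesis by simp
qed

text \<open>For \<zeta> = exp(2 \<pi> i / (d + 1)) and an exponent between 1 and \<open>d\<close>,
  the power of \<zeta> is a root of unity of order dividing d + 1 and different from 1, so the
  geometric sum vanishes.\<close>

lemma primitive_root_exists:
  obtains \<zeta> where "cmod \<zeta> = 1" "\<And>i. 0 < i \<Longrightarrow> i \<le> d \<Longrightarrow> (\<Sum>j<Suc d. (\<zeta> ^ j) ^ i) = 0"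
proof -
  let ?z = "cis (2 * pi / Suc d)"
  have "(\<Sum>j<Suc d. (?z ^ j) ^ i) = 0" if i: "0 < i" "i \<le> d" for i
  proof -
    have zi: "?z ^ i = cis (2 * pi * i / Suc d)" by (subst Complex.DeMoivre) (simp add: field_simps)
    have ne: "?z ^ i \<noteq> 1"
    proof
      assume "?z ^ i = 1"
      then have "cos (2 * pi * i / Suc d) = 1" unfolding zi by (metis cis.sel(1) one_complex.sel(1))
      then obtain n :: int where "2 * pi * i / Suc d = real_of_int n * 2 * pi" unfolding cos_one_2pi_int by blast
      then have "2 * pi * i = 2 * pi * (n * Suc d)" by (simp add: field_simps)
      then have "real i = n * Suc d" by simp
      then have eq: "int i = n * int (Suc d)" by (metis of_int_eq_iff of_int_mult of_int_of_nat_eq)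
      then have "int (Suc d) dvd int i" by simp
      then have "Suc d dvd i" by presburger
      then show False using i by (auto dest: dvd_imp_le)
    qed
    have "(?z ^ i) ^ Suc d = (?z ^ Suc d) ^ i" by (metis power_mult mult.commute)
    also have "?z ^ Suc d = 1" unfolding Complex.DeMoivre by (simp del: of_nat_Suc)
    finally have one: "(?z ^ i) ^ Suc d = 1" by simp
    have "(?z ^ j) ^ i = (?z ^ i) ^ j" for j by (metis power_mult mult.commute)
    then have "(\<Sum>j<Suc d. (?z ^ j) ^ i) = (\<Sum>j<Suc d. (?z ^ i) ^ j)" by simp
    also have "\<dots> = 0" using geometric_sum[OF ne, of "Suc d"] one by simp
    finally show ?thesis .
  qed
  then show thesis using that[of ?z] by auto
qed

text \<open>Averaging over the roots of unity kills the monomials of degrees 1 to \<open>d\<close>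
  and leaves the constant coefficient, which is the value at \<open>x\<close>.\<close>

lemma mean_value_on_roots:
  fixes \<Phi> :: "'a::complex_normed_vector \<Rightarrow> complex"
  assumes z: "\<And>i. 0 < i \<Longrightarrow> i \<le> d \<Longrightarrow> (\<Sum>j<Suc d. (\<zeta> ^ j) ^ i) = 0"
    and c: "\<And>l. \<Phi> (x + l *\<^sub>C u) = (\<Sum>i\<le>d. c i * l ^ i)"
  shows "(\<Sum>j<Suc d. \<Phi> (x + \<zeta> ^ j *\<^sub>C u)) = of_nat (Suc d) * \<Phi> x"
proof -
  have "(\<Sum>j<Suc d. \<Phi> (x + \<zeta> ^ j *\<^sub>C u)) = (\<Sum>j<Suc d. \<Sum>i\<le>d. c i * (\<zeta> ^ j) ^ i)"
    unfolding c ..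
  also have "\<dots> = (\<Sum>i\<le>d. c i * (\<Sum>j<Suc d. (\<zeta> ^ j) ^ i))"
    unfolding sum_distrib_left by (rule sum.swap)
  also have "\<dots> = (\<Sum>i\<le>d. if i = 0 then c 0 * of_nat (Suc d) else 0)"
    using z by (intro sum.cong) auto
  also have "\<dots> = of_nat (Suc d) * c 0" by simp
  also have "c 0 = \<Phi> x"
  proof -
    have "\<Phi> x = (\<Sum>i\<le>d. c i * 0 ^ i)" using c[of 0] by simp
    also have "\<dots> = (\<Sum>i\<le>d. if i = 0 then c 0 else 0)" by (intro sum.cong) auto
    finally show ?thesis by simp
  qed
  finally show ?thesis .
qed

text \<open>
  Choosing the coefficients \<open>l i\<close> as independent uniform roots of unity turns the partial sums into a
  martingale, by the mean value property; the increments of a bounded martingale are square summable.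
\<close>

lemma mean_square_increments:
  fixes \<Phi> :: "'a::complex_normed_vector \<Rightarrow> complex" and u :: "nat \<Rightarrow> 'a"
  assumes Z: "complex_vector.subspace Z" and u: "\<And>i. u i \<in> Z"
    and line: "\<And>x u. x \<in> Z \<Longrightarrow> u \<in> Z \<Longrightarrow> \<exists>c. \<forall>l. \<Phi> (x + l *\<^sub>C u) = (\<Sum>i\<le>d. c i * l ^ i)"
    and x: "x \<in> Z"
    and B: "\<And>l. (\<And>i. cmod (l i) = 1) \<Longrightarrow> cmod (\<Phi> (x + (\<Sum>i<N. l i *\<^sub>C u i))) \<le> B"
  shows "(cmod (\<Phi> x))\<^sup>2 + (\<Sum>i<N. (cmod (\<Phi> (x + u i) - \<Phi> x))\<^sup>2) / Suc d \<le> B\<^sup>2"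
  using x B
proof (induction N arbitrary: x)
  case 0
  have "cmod (\<Phi> x) \<le> B" using 0(2)[of "\<lambda>_. 1"] by simp
  then show ?case by (simp add: power_mono)
next
  case (Suc N)
  obtain \<zeta> where \<zeta>: "cmod \<zeta> = 1" "\<And>i. 0 < i \<Longrightarrow> i \<le> d \<Longrightarrow> (\<Sum>j<Suc d. (\<zeta> ^ j) ^ i) = 0"
    using primitive_root_exists by blast
  \<comment> \<open>The coefficient of \<open>u N\<close> runs through the d + 1 roots of unity, and
    the induction hypothesis is applied at each resulting base point \<open>y j\<close>.\<close>
  define y where "y j = x + \<zeta> ^ j *\<^sub>C u N" for j
  define D where "D i j = \<Phi> (y j + u i) - \<Phi> (y j)" for i j
  have yZ: "y j \<in> Z" for j
    unfolding y_def by (intro complex_vector.subspace_add complex_vector.subspace_scale Z Suc.prems u)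
  have mv: "(\<Sum>j<Suc d. \<Phi> (z + \<zeta> ^ j *\<^sub>C u N)) = of_nat (Suc d) * \<Phi> z" if "z \<in> Z" for z
    using line[OF that u[of N]] mean_value_on_roots[OF \<zeta>(2)] by blast
  have IH: "(cmod (\<Phi> (y j)))\<^sup>2 + (\<Sum>i<N. (cmod (D i j))\<^sup>2) / Suc d \<le> B\<^sup>2" for j
    unfolding D_def
  proof (rule Suc.IH[OF yZ])
    fix l :: "nat \<Rightarrow> complex" assume l: "\<And>i. cmod (l i) = 1"
    have "cmod (\<Phi> (x + (\<Sum>i<Suc N. (l(N := \<zeta> ^ j)) i *\<^sub>C u i))) \<le> B"
      using l \<zeta> by (intro Suc.prems) (auto simp: norm_power)
    moreover have "x + (\<Sum>i<Suc N. (l(N := \<zeta> ^ j)) i *\<^sub>C u i) = y j + (\<Sum>i<N. l i *\<^sub>C u i)"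
      by (simp add: y_def algebra_simps)
    ultimately show "cmod (\<Phi> (y j + (\<Sum>i<N. l i *\<^sub>C u i))) \<le> B" by (simp only:)
  qed
  have "(\<Sum>j<Suc d. (cmod (\<Phi> (y j)))\<^sup>2) + (\<Sum>i<N. \<Sum>j<Suc d. (cmod (D i j))\<^sup>2) / Suc d
      = (\<Sum>j<Suc d. (cmod (\<Phi> (y j)))\<^sup>2 + (\<Sum>i<N. (cmod (D i j))\<^sup>2) / Suc d)"
    by (subst sum.swap) (simp only: sum.distrib sum_divide_distrib)
  also have "\<dots> \<le> (\<Sum>j<Suc d. B\<^sup>2)" by (rule sum_mono) (rule IH)
  finally have le: "(\<Sum>j<Suc d. (cmod (\<Phi> (y j)))\<^sup>2) + (\<Sum>i<N. \<Sum>j<Suc d. (cmod (D i j))\<^sup>2) / Suc d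
      \<le> Suc d * B\<^sup>2" by simp
  \<comment> \<open>The deviation with j = 0 is the increment by \<open>u N\<close>, because
    \<open>\<zeta> ^ 0 = 1\<close>. Keeping one out of d + 1 deviations is the source of the factor
    \<open>Suc d\<close>.\<close>
  have a: "Suc d * (cmod (\<Phi> x))\<^sup>2 + (cmod (\<Phi> (x + u N) - \<Phi> x))\<^sup>2 \<le> (\<Sum>j<Suc d. (cmod (\<Phi> (y j)))\<^sup>2)"
  proof -
    have "(cmod (\<Phi> (y 0) - \<Phi> x))\<^sup>2 \<le> (\<Sum>j<Suc d. (cmod (\<Phi> (y j) - \<Phi> x))\<^sup>2)"
      by (rule member_le_sum) auto
    moreover have "y 0 = x + u N" by (simp add: y_def)
    ultimately show ?thesis
      using sum_square_deviation[OF mv[OF Suc.prems(1)]] unfolding y_def by simp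
  qed
  \<comment> \<open>By the mean value property at \<open>x + u i\<close> and at \<open>x\<close>,
    the average of \<open>D i j\<close> over \<open>j\<close> is the increment at \<open>x\<close>;
    its squared modulus is at most the average of the squared moduli.\<close>
  have b: "Suc d * (cmod (\<Phi> (x + u i) - \<Phi> x))\<^sup>2 \<le> (\<Sum>j<Suc d. (cmod (D i j))\<^sup>2)" for i
  proof -
    have xu: "x + u i \<in> Z" by (intro complex_vector.subspace_add Z Suc.prems u)
    have "(\<Sum>j<Suc d. D i j) = of_nat (Suc d) * (\<Phi> (x + u i) - \<Phi> x)"
      using mv[OF xu] mv[OF Suc.prems(1)]
      by (simp only: D_def y_def sum_subtractf right_diff_distrib add.commute[of _ "u i"] add.left_commute[of _ x] add.assoc)
    from sum_square_deviation[OF this] show ?thesis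
      by (smt (verit) sum_nonneg zero_le_power2)
  qed
  have "Suc d * (\<Sum>i<N. (cmod (\<Phi> (x + u i) - \<Phi> x))\<^sup>2) \<le> (\<Sum>i<N. \<Sum>j<Suc d. (cmod (D i j))\<^sup>2)"
    unfolding sum_distrib_left by (rule sum_mono) (rule b)
  then have "(\<Sum>i<N. (cmod (\<Phi> (x + u i) - \<Phi> x))\<^sup>2) \<le> (\<Sum>i<N. \<Sum>j<Suc d. (cmod (D i j))\<^sup>2) / Suc d"
    by (simp add: pos_le_divide_eq mult.commute del: sum.lessThan_Suc)
  with a le have "Suc d * (cmod (\<Phi> x))\<^sup>2 + (\<Sum>i<Suc N. (cmod (\<Phi> (x + u i) - \<Phi> x))\<^sup>2) \<le> Suc d * B\<^sup>2"
    by (simp only: sum.lessThan_Suc[of _ N])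
  then have "(Suc d * (cmod (\<Phi> x))\<^sup>2 + (\<Sum>i<Suc N. (cmod (\<Phi> (x + u i) - \<Phi> x))\<^sup>2)) / Suc d \<le> B\<^sup>2"
    by (simp only: pos_divide_le_eq of_nat_0_less_iff zero_less_Suc mult.commute)
  then show ?case by (simp only: add_divide_distrib nonzero_mult_div_cancel_left of_nat_eq_0_iff nat.distinct not_False_eq_True)
qed

text \<open>The hypothesis on \<open>u\<close> makes it behave like the unit vectors of \<open>c\<^sub>0\<close>.\<close>

lemma scalar_polynomial_on_tendsto:
  fixes \<Phi> :: "'a::complex_normed_vector \<Rightarrow> complex" and u :: "nat \<Rightarrow> 'a"
  assumes Z: "complex_vector.subspace Z" and \<Phi>: "scalar_polynomial_on Z \<Phi>"
    and u: "\<And>i. u i \<in> Z" and x: "x \<in> Z"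
    and C: "\<And>l N. (\<And>i. cmod (l i) = 1) \<Longrightarrow> norm (\<Sum>i<N. l i *\<^sub>C u i) \<le> C"
  shows "(\<lambda>i. \<Phi> (x + u i)) \<longlonglongrightarrow> \<Phi> x"
proof -
  obtain d where d: "\<And>x u. x \<in> Z \<Longrightarrow> u \<in> Z \<Longrightarrow> \<exists>c. \<forall>l. \<Phi> (x + l *\<^sub>C u) = (\<Sum>i\<le>d. c i * l ^ i)"
    using \<Phi> unfolding scalar_polynomial_on_def by blast
  obtain B where B: "\<And>y. y \<in> Z \<Longrightarrow> norm y \<le> norm x + C \<Longrightarrow> cmod (\<Phi> y) \<le> B"
    using \<Phi> unfolding scalar_polynomial_on_def by blast
  have "summable (\<lambda>i. (cmod (\<Phi> (x + u i) - \<Phi> x))\<^sup>2)"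
  proof (rule bounded_imp_summable)
    fix n
    have "(cmod (\<Phi> x))\<^sup>2 + (\<Sum>i<Suc n. (cmod (\<Phi> (x + u i) - \<Phi> x))\<^sup>2) / Suc d \<le> B\<^sup>2"
    proof (rule mean_square_increments[OF Z u d x])
      fix l :: "nat \<Rightarrow> complex" assume l: "\<And>i. cmod (l i) = 1"
      show "cmod (\<Phi> (x + (\<Sum>i<Suc n. l i *\<^sub>C u i))) \<le> B"
      proof (rule B)
        show "x + (\<Sum>i<Suc n. l i *\<^sub>C u i) \<in> Z"
          by (intro complex_vector.subspace_add complex_vector.subspace_sum complex_vector.subspace_scale Z u x)
        show "norm (x + (\<Sum>i<Suc n. l i *\<^sub>C u i)) \<le> norm x + C"
          by (rule norm_triangle_le) (rule add_left_mono, rule C, rule l)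
      qed
    qed
    then have "(\<Sum>i<Suc n. (cmod (\<Phi> (x + u i) - \<Phi> x))\<^sup>2) / Suc d \<le> B\<^sup>2"
      using zero_le_power2[of "cmod (\<Phi> x)"] by linarith
    then have "(\<Sum>i<Suc n. (cmod (\<Phi> (x + u i) - \<Phi> x))\<^sup>2) \<le> B\<^sup>2 * Suc d"
      by (simp only: pos_divide_le_eq of_nat_0_less_iff zero_less_Suc)
    then show "(\<Sum>i\<le>n. (cmod (\<Phi> (x + u i) - \<Phi> x))\<^sup>2) \<le> B\<^sup>2 * Suc d"
      by (simp only: lessThan_Suc_atMost)
  qed simp
  then have "(\<lambda>i. (cmod (\<Phi> (x + u i) - \<Phi> x))\<^sup>2) \<longlonglongrightarrow> 0" by (rule summable_LIMSEQ_zero)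
  then have "(\<lambda>i. cmod (\<Phi> (x + u i) - \<Phi> x)) \<longlonglongrightarrow> 0"
    using tendsto_real_sqrt[of _ 0] by fastforce
  then have "(\<lambda>i. \<Phi> (x + u i) - \<Phi> x) \<longlonglongrightarrow> 0" by (rule tendsto_norm_zero_cancel)
  then show ?thesis by (rule LIM_zero_cancel)
qed

section \<open>Spikes at non-isolated points\<close>

lemma disjoint_family_indicator_sum_le:
  fixes c :: real and U :: "nat \<Rightarrow> 'b set"
  assumes "disjoint_family U" "0 \<le> c"
  shows "(\<Sum>i<N. if x \<in> U i then c else 0) \<le> c"
proof (cases "\<exists>i. x \<in> U i")
  case True
  then obtain i where i: "x \<in> U i" by blast
  then have "x \<in> U j \<longleftrightarrow> j = i" for j using assms unfolding disjoint_family_on_def by blast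
  then show ?thesis using assms by simp
qed (use assms in simp)

locale perfect_uniform_alg = uniform_alg +
  assumes no_isolated: "\<not> t isolated_in shilov"
begin

section \<open>Disjoint open sets meeting the Shilov boundary\<close>

lemma open_meets_twice:
  assumes "open V" "p \<in> V \<inter> shilov"
  obtains q where "q \<in> V \<inter> shilov" "q \<noteq> p"
  using assms no_isolated[of p] unfolding isolated_in_def by blast

lemma open_minus_finite_meets:
  assumes "finite F" "open V" "V \<inter> shilov \<noteq> {}"
  shows "(V - F) \<inter> shilov \<noteq> {}"
  using assms(1)
proof (induction F rule: finite_induct)
  case empty
  then show ?case using assms by simp
next
  case (insert p F)
  have "open (V - F)" using insert assms by (simp add: finite_imp_closed open_Diff)
  then show ?case using insert.IH open_meets_twice[of "V - F"] by blast
qed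

lemma split_open:
  assumes "open V" "V \<inter> shilov \<noteq> {}"
  obtains U W where "open U" "open W" "U \<subseteq> V" "W \<subseteq> V" "U \<inter> W = {}"
    "U \<inter> shilov \<noteq> {}" "W \<inter> shilov \<noteq> {}"
proof -
  obtain p where p: "p \<in> V \<inter> shilov" using assms by blast
  obtain q where q: "q \<in> V \<inter> shilov" "q \<noteq> p" using open_meets_twice[OF assms(1) p] by blast
  obtain U W where "open U" "open W" "p \<in> U" "q \<in> W" "U \<inter> W = {}"
    using hausdorff[of p q] q by metis
  then show thesis using p q assms by (intro that[of "U \<inter> V" "W \<inter> V"]) auto
qed

text \<open>Open sets meeting \<open>shilov\<close> are split repeatedly: the first component of
  each pair is kept and the second one is split again at the next stage.\<close>

lemma disjoint_open_sequence:
  assumes "open V" "V \<inter> shilov \<noteq> {}"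
  obtains U :: "nat \<Rightarrow> 'a set" where "\<And>n. open (U n)" "\<And>n. U n \<subseteq> V" "\<And>n. U n \<inter> shilov \<noteq> {}"
    "disjoint_family U"
proof -
  define I where "I X \<longleftrightarrow> open (fst X) \<and> open (snd X) \<and> fst X \<subseteq> V \<and> snd X \<subseteq> V \<and> fst X \<inter> snd X = {} \<and>
    fst X \<inter> shilov \<noteq> {} \<and> snd X \<inter> shilov \<noteq> {}" for X :: "'a set \<times> 'a set"
  have "\<exists>X. \<forall>n. I (X n) \<and> (fst (X (Suc n)) \<subseteq> snd (X n) \<and> snd (X (Suc n)) \<subseteq> snd (X n))"
  proof (rule dependent_nat_choice)
    obtain U W where "open U" "open W" "U \<subseteq> V" "W \<subseteq> V" "U \<inter> W = {}"
      "U \<inter> shilov \<noteq> {}" "W \<inter> shilov \<noteq> {}" by (rule split_open[OF assms])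
    then show "\<exists>X. I X" by (intro exI[of _ "(U, W)"]) (simp add: I_def)
  next
    fix X n assume "I X"
    then have X: "open (snd X)" "snd X \<inter> shilov \<noteq> {}" "snd X \<subseteq> V" by (auto simp: I_def)
    obtain U W where "open U" "open W" "U \<subseteq> snd X" "W \<subseteq> snd X" "U \<inter> W = {}"
      "U \<inter> shilov \<noteq> {}" "W \<inter> shilov \<noteq> {}" by (rule split_open[OF X(1,2)])
    then show "\<exists>Y. I Y \<and> (fst Y \<subseteq> snd X \<and> snd Y \<subseteq> snd X)"
      using X(3) by (intro exI[of _ "(U, W)"]) (auto simp: I_def)
  qed
  then obtain X where X: "\<And>n. I (X n)" "\<And>n. fst (X (Suc n)) \<subseteq> snd (X n)" "\<And>n. snd (X (Suc n)) \<subseteq> snd (X n)"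
    by blast
  have dec: "snd (X n) \<subseteq> snd (X m)" if "m \<le> n" for m n
    using that X(3) by (rule lift_Suc_antimono_le[rotated])
  have "fst (X m) \<inter> fst (X n) = {}" if "m < n" for m n
  proof -
    obtain k where k: "n = Suc k" "m \<le> k" using \<open>m < n\<close> less_Suc_eq_le by (cases n) auto
    then have "fst (X n) \<subseteq> snd (X m)" using X(2)[of k] dec[of m k] by blast
    then show ?thesis using X(1)[of m] unfolding I_def by blast
  qed
  then have "disjoint_family (\<lambda>n. fst (X n))"
    unfolding disjoint_family_on_def by (metis inf_commute linorder_neqE_nat)
  then show thesis using X(1) by (intro that[of "\<lambda>n. fst (X n)"]) (auto simp: I_def)
qed

text \<open>Take \<open>u\<close> as \<open>b - a\<close> times \<open>g\<close>, with
  \<open>a\<close> the value of \<open>s\<close> at the peak \<open>t\<close> and \<open>g\<close>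
  from \<open>peak_near_interval\<close>. On a small neighbourhood, where \<open>s\<close> is almost
  \<open>a\<close> and \<open>g\<close> almost some \<open>r\<close> in [0, 1], \<open>s + u\<close>
  is almost the convex combination (1 - r) a + r b of modulus at most \<open>c\<close>; elsewhere on
  \<open>shilov\<close> the function \<open>g\<close> is small.\<close>

lemma spike:
  assumes "s \<in> A" "norm s \<le> c" "cmod b \<le> c" "c \<le> 1" "open U" "U \<inter> shilov \<noteq> {}" "0 < e" "e \<le> 1"
  obtains u t where "u \<in> A" "t \<in> U \<inter> shilov" "apply_bcontfun (s + u) t = b"
    "norm (s + u) \<le> c + 4 * e" "norm u \<le> 4"
    "\<And>x. x \<in> shilov - U \<Longrightarrow> cmod (apply_bcontfun u x) \<le> 2 * e"
proof -
  obtain p where p: "p \<in> U \<inter> shilov" using assms by blast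
  let ?U = "U \<inter> {x. cmod (apply_bcontfun s x - apply_bcontfun s p) < e}"
  have op: "open ?U" using assms(5) by (intro open_Int norm_level_sets)
  have ne: "?U \<inter> shilov \<noteq> {}" using assms(7) p by auto
  obtain g t where g: "g \<in> A" "t \<in> ?U \<inter> shilov" "apply_bcontfun g t = 1"
    "\<And>s. s \<in> shilov - ?U \<Longrightarrow> cmod (apply_bcontfun g s) \<le> e"
    "\<And>s. \<exists>r\<in>{0..1}. cmod (apply_bcontfun g s - of_real r) \<le> e"
    using peak_near_interval[OF op ne assms(7)] by blast
  define a where "a = apply_bcontfun s t"
  have sc: "cmod (apply_bcontfun s x) \<le> c" for x using norm_bounded[of s x] assms by simp
  have ab: "cmod (b - a) \<le> 2"
    using norm_triangle_ineq4[of b a] sc[of t] assms unfolding a_def by simp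
  define u where "u = (b - a) *\<^sub>C g"
  have u: "apply_bcontfun u x = (b - a) * apply_bcontfun g x" for x by (simp add: u_def)
  have ug: "cmod (apply_bcontfun u x) \<le> 2 * cmod (apply_bcontfun g x)" for x
    unfolding u norm_mult using ab by (intro mult_right_mono) auto
  have off: "cmod (apply_bcontfun u x) \<le> 2 * e" if "x \<in> shilov - ?U" for x
    using ug[of x] g(4)[OF that] by simp
  show thesis
  proof (rule that)
    show uA: "u \<in> A" unfolding u_def using g by (intro scaleC_mem)
    show "t \<in> U \<inter> shilov" using g by blast
    show "apply_bcontfun (s + u) t = b" using g by (simp add: u a_def)
    show "cmod (apply_bcontfun u x) \<le> 2 * e" if "x \<in> shilov - U" for x using off that by blast
    show "norm u \<le> 4"
    proof (rule norm_bound)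
      fix x
      obtain r where "r \<in> {0..1}" "cmod (apply_bcontfun g x - of_real r) \<le> e" using g(5) by blast
      then have "cmod (apply_bcontfun g x) \<le> 2"
        using norm_triangle_ineq[of "apply_bcontfun g x - of_real r" "of_real r"] assms(8) by auto
      then show "cmod (apply_bcontfun u x) \<le> 4" using ug[of x] by simp
    qed
    show "norm (s + u) \<le> c + 4 * e"
    proof (rule norm_le_shilov)
      show "s + u \<in> A" using assms uA by (intro add_mem)
      fix x assume x: "x \<in> shilov"
      show "cmod (apply_bcontfun (s + u) x) \<le> c + 4 * e"
      proof (cases "x \<in> ?U")
        case True
        obtain r where r: "r \<in> {0..1}" "cmod (apply_bcontfun g x - of_real r) \<le> e" using g(5) by blast
        have "cmod (apply_bcontfun s x - apply_bcontfun s p) < e"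
          "cmod (apply_bcontfun s t - apply_bcontfun s p) < e" using True g(2) by auto
        then have "cmod (apply_bcontfun s x - a) < 2 * e"
          unfolding a_def
          using norm_triangle_ineq4[of "apply_bcontfun s x - apply_bcontfun s p" "apply_bcontfun s t - apply_bcontfun s p"]
          by simp
        moreover have "cmod ((b - a) * (apply_bcontfun g x - of_real r)) \<le> 2 * e"
          unfolding norm_mult using ab r by (intro mult_mono) auto
        moreover have "cmod (of_real (1 - r) * a + of_real r * b) \<le> c"
        proof -
          have "cmod (of_real (1 - r) * a + of_real r * b) \<le> (1 - r) * cmod a + r * cmod b"
            using r norm_triangle_ineq[of "of_real (1 - r) * a" "of_real r * b"]
            by (simp add: norm_mult del: of_real_diff)
          also have "\<dots> \<le> (1 - r) * c + r * c"
            using r sc[of t] assms unfolding a_def by (intro add_mono mult_left_mono) auto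
          finally show ?thesis by (simp add: algebra_simps)
        qed
        \<comment> \<open>The excess \<open>4 * e\<close> over \<open>c\<close> consists of
          \<open>2 * e\<close> from the variation of \<open>s\<close> on \<open>?U\<close> and at
          most \<open>2 * e\<close> from the distance of \<open>g\<close> to [0, 1], as
          \<open>b - a\<close> has modulus at most 2.\<close>
        moreover have eq: "apply_bcontfun (s + u) x = (apply_bcontfun s x - a) +
            (b - a) * (apply_bcontfun g x - of_real r) + (of_real (1 - r) * a + of_real r * b)"
          by (simp add: u algebra_simps)
        ultimately show ?thesis
          unfolding eq
          using norm_triangle_ineq[of "(apply_bcontfun s x - a) + (b - a) * (apply_bcontfun g x - of_real r)"
              "of_real (1 - r) * a + of_real r * b"]
            norm_triangle_ineq[of "apply_bcontfun s x - a" "(b - a) * (apply_bcontfun g x - of_real r)"]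
          by linarith
      next
        case False
        then show ?thesis
          using off[of x] sc[of x] x assms(7) norm_triangle_ineq[of "apply_bcontfun s x" "apply_bcontfun u x"]
          by simp
      qed
    qed
  qed
qed

text \<open>One spike is put into each of infinitely many disjoint open subsets of
  \<open>V - F\<close>, with summable errors outside. At each point of \<open>shilov\<close> at most
  one spike is large, so unimodular combinations of the spikes stay bounded and
  \<open>scalar_polynomial_on_tendsto\<close> applies. Points of \<open>F\<close> lie in none of
  these sets, so the values there hardly change.\<close>

proposition spike_sequence:
  assumes s: "s \<in> A" "norm s < 1" and b: "cmod b < 1" and V: "open V" "V \<inter> shilov \<noteq> {}"
    and F: "finite F" "F \<subseteq> shilov" and d: "0 < d"
  obtains y :: "nat \<Rightarrow> 'a \<Rightarrow>\<^sub>C complex" and t :: "nat \<Rightarrow> 'a"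
  where "\<And>k. y k \<in> A" "\<And>k. norm (y k) < 1" "\<And>k. t k \<in> V \<inter> shilov"
    "\<And>k. apply_bcontfun (y k) (t k) = b"
    "\<And>k p. p \<in> F \<Longrightarrow> cmod (apply_bcontfun (y k) p - apply_bcontfun s p) < d"
    "\<And>\<Phi>. scalar_polynomial_on A \<Phi> \<Longrightarrow> (\<lambda>k. \<Phi> (y k)) \<longlonglongrightarrow> \<Phi> s"
proof -
  define c where "c = max (norm s) (cmod b)"
  have c: "norm s \<le> c" "cmod b \<le> c" "0 \<le> c" "c < 1" using s b by (auto simp: c_def le_max_iff_disj)
  \<comment> \<open>The divisor 5 leaves room for the strict bounds \<open>c + 4 * e < 1\<close> and
    \<open>2 * e < d\<close>.\<close>
  define e where "e = min d (1 - c) / 5"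
  have e: "0 < e" "c + 4 * e < 1" "2 * e < d" "e \<le> 1"
  proof -
    have "5 * e \<le> d" "5 * e \<le> 1 - c" "0 < e" using c d by (simp_all add: e_def)
    then show "0 < e" "c + 4 * e < 1" "2 * e < d" "e \<le> 1" using c by linarith+
  qed
  define \<epsilon> where "\<epsilon> k = e * (1/2) ^ k" for k :: nat
  have \<epsilon>: "0 < \<epsilon> k" "\<epsilon> k \<le> e" for k using e by (simp_all add: \<epsilon>_def mult_left_le power_le_one)
  have opn: "open (V - F)" using V F by (simp add: finite_imp_closed open_Diff)
  obtain U :: "nat \<Rightarrow> 'a set" where U: "\<And>n. open (U n)" "\<And>n. U n \<subseteq> V - F" "\<And>n. U n \<inter> shilov \<noteq> {}" "disjoint_family U"
    using disjoint_open_sequence[OF opn open_minus_finite_meets[OF F(1) V]] by blast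
  define Q where "Q k u t \<longleftrightarrow> u \<in> A \<and> t \<in> U k \<inter> shilov \<and> apply_bcontfun (s + u) t = b \<and>
    norm (s + u) \<le> c + 4 * \<epsilon> k \<and> norm u \<le> 4 \<and>
    (\<forall>x\<in>shilov - U k. cmod (apply_bcontfun u x) \<le> 2 * \<epsilon> k)" for k u t
  have "\<exists>u t. Q k u t" for k
  proof -
    have "\<epsilon> k \<le> 1" using \<epsilon>(2)[of k] e(4) by linarith
    then obtain u t where "u \<in> A" "t \<in> U k \<inter> shilov" "apply_bcontfun (s + u) t = b"
      "norm (s + u) \<le> c + 4 * \<epsilon> k" "norm u \<le> 4"
      "\<And>x. x \<in> shilov - U k \<Longrightarrow> cmod (apply_bcontfun u x) \<le> 2 * \<epsilon> k"
      using spike[OF s(1) c(1,2) less_imp_le[OF c(4)] U(1,3)[of k] \<epsilon>(1)] by metis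
    then show ?thesis unfolding Q_def by (intro exI conjI ballI)
  qed
  then obtain u t where "\<And>k. Q k (u k) (t k)" by metis
  then have u: "\<And>k. u k \<in> A" "\<And>k. t k \<in> U k \<inter> shilov"
    "\<And>k. apply_bcontfun (s + u k) (t k) = b" "\<And>k. norm (s + u k) \<le> c + 4 * \<epsilon> k" "\<And>k. norm (u k) \<le> 4"
    "\<And>k x. x \<in> shilov - U k \<Longrightarrow> cmod (apply_bcontfun (u k) x) \<le> 2 * \<epsilon> k"
    unfolding Q_def by simp_all
  show thesis
  proof (rule that[of "\<lambda>k. s + u k" t])
    show "s + u k \<in> A" for k using s u by (intro add_mem)
    show "norm (s + u k) < 1" for k using u(4)[of k] \<epsilon>(2)[of k] e by linarith
    show "t k \<in> V \<inter> shilov" for k using u(2)[of k] U(2)[of k] by blast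
    show "apply_bcontfun (s + u k) (t k) = b" for k by (rule u)
    show "cmod (apply_bcontfun (s + u k) p - apply_bcontfun s p) < d" if "p \<in> F" for k p
    proof -
      have "p \<in> shilov - U k" using that F U(2)[of k] by blast
      from u(6)[OF this] show ?thesis using \<epsilon>(2)[of k] e by simp
    qed
    show "(\<lambda>k. \<Phi> (s + u k)) \<longlonglongrightarrow> \<Phi> s" if "scalar_polynomial_on A \<Phi>" for \<Phi>
    proof (rule scalar_polynomial_on_tendsto[OF subspace that u(1) s(1)])
      fix l :: "nat \<Rightarrow> complex" and N assume l: "\<And>i. cmod (l i) = 1"
      \<comment> \<open>The bound 8 is 4 for the one spike that may be large, plus at most 4 for the
        geometric sum of the errors \<open>2 * \<epsilon> i\<close>.\<close>
      show "norm (\<Sum>i<N. l i *\<^sub>C u i) \<le> 8"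
      proof (rule norm_le_shilov)
        show "(\<Sum>i<N. l i *\<^sub>C u i) \<in> A" using u by (intro sum_mem scaleC_mem)
        fix x assume x: "x \<in> shilov"
        have ap: "apply_bcontfun (\<Sum>i<N. l i *\<^sub>C u i) x = (\<Sum>i<N. l i * apply_bcontfun (u i) x)"
          by (induction N) simp_all
        have "cmod (apply_bcontfun (u i) x) \<le> 2 * \<epsilon> i + (if x \<in> U i then 4 else 0)" for i
          using u(6)[of x i] x norm_bounded[of "u i" x] u(5)[of i] \<epsilon>(1)[of i] by (auto split: if_splits)
        then have "cmod (\<Sum>i<N. l i * apply_bcontfun (u i) x) \<le> (\<Sum>i<N. 2 * \<epsilon> i + (if x \<in> U i then 4 else 0))"
          by (intro sum_norm_le) (simp add: norm_mult l)
        also have "\<dots> = 2 * e * (\<Sum>i<N. (1/2) ^ i) + (\<Sum>i<N. if x \<in> U i then 4 else 0)"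
          by (simp add: sum.distrib \<epsilon>_def sum_distrib_left mult.assoc)
        also have "\<dots> \<le> 2 * e * 2 + 4"
        proof (intro add_mono mult_left_mono)
          show "(\<Sum>i<N. (1/2::real) ^ i) \<le> 2" using geometric_sum[of "1/2::real" N] by simp
          show "(\<Sum>i<N. if x \<in> U i then 4 else 0::real) \<le> 4"
            using disjoint_family_indicator_sum_le[OF U(4)] by simp
        qed (use e in simp)
        finally show "cmod (apply_bcontfun (\<Sum>i<N. l i *\<^sub>C u i) x) \<le> 8" using e by (simp add: ap)
      qed
    qed
  qed
qed

end

section \<open>Implications valid in every Banach space\<close>

lemma zero_in_unit_ball: "complex_vector.subspace Z \<Longrightarrow> 0 \<in> unit_ball Z"
  by (simp add: unit_ball_def complex_vector.subspace_0)

lemma ball_norm_le: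
  assumes "complex_vector.subspace Z" "\<And>z. z \<in> unit_ball Z \<Longrightarrow> norm (P z) \<le> c"
  shows "ball_norm Z P \<le> c"
  unfolding ball_norm_def using zero_in_unit_ball[OF assms(1)] by (intro cSUP_least assms) auto

text \<open>The bound \<open>c\<close> ensures that the supremum is taken over a set bounded
  above.\<close>

lemma norm_le_ball_norm:
  assumes "\<And>z. z \<in> unit_ball Z \<Longrightarrow> norm (P z) \<le> c" "z \<in> unit_ball Z"
  shows "norm (P z) \<le> ball_norm Z P"
  unfolding ball_norm_def using assms by (intro cSUP_upper bdd_aboveI2) auto

lemma bounded_clinear_on_unit_ball:
  assumes "bounded_clinear_on Z T"
  obtains C where "\<And>z. z \<in> unit_ball Z \<Longrightarrow> norm (T z) \<le> C"
proof -
  obtain C where C: "\<And>x. x \<in> Z \<Longrightarrow> norm (T x) \<le> C * norm x"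
    using assms unfolding bounded_clinear_on_def by blast
  have "norm (T z) \<le> \<bar>C\<bar>" if "z \<in> unit_ball Z" for z
  proof -
    have "norm (T z) \<le> C * norm z" using C that by (simp add: unit_ball_def)
    also have "\<dots> \<le> \<bar>C\<bar> * 1" using that by (intro mult_mono) (auto simp: unit_ball_def)
    finally show ?thesis by simp
  qed
  then show thesis by (rule that)
qed

lemma scaleC_minus_one: "(- 1) *\<^sub>C x = - (x :: 'a::complex_normed_vector)"
  by (metis complex_vector.scale_minus_left scaleC_one)

lemma rank_one_operator_uminus:
  assumes Z: "complex_vector.subspace Z" and T: "rank_one_operator Z T"
  shows "rank_one_operator Z (\<lambda>z. - T z)"
proof -
  have lin: "bounded_clinear_on Z T" using T by (simp add: rank_one_operator_def)
  have neg: "T (- z) = - T z" if "z \<in> Z" for z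
    using lin that unfolding bounded_clinear_on_def by (metis scaleC_minus_one)
  have "(\<lambda>z. - T z) ` Z = T ` Z"
  proof (intro equalityI subsetI)
    fix y assume "y \<in> (\<lambda>z. - T z) ` Z"
    then obtain z where "z \<in> Z" "y = - T z" by blast
    then show "y \<in> T ` Z" using neg complex_vector.subspace_neg[OF Z] by (intro image_eqI[of _ _ "- z"]) auto
  next
    fix y assume "y \<in> T ` Z"
    then obtain z where "z \<in> Z" "y = T z" by blast
    then show "y \<in> (\<lambda>z. - T z) ` Z"
      using neg complex_vector.subspace_neg[OF Z] by (intro image_eqI[of _ _ "- z"]) auto
  qed
  moreover have "bounded_clinear_on Z (\<lambda>z. - T z)"
    using lin unfolding bounded_clinear_on_def by simp
  ultimately show ?thesis using T by (simp add: rank_one_operator_def)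
qed

text \<open>A basis of the range consists of one vector, normalised to \<open>v\<close>. The
  coefficient \<phi> of \<open>T z\<close> with respect to \<open>v\<close> inherits linearity from
  \<open>T\<close> because \<open>v\<close> is nonzero, and the bound because \<open>v\<close> has
  norm 1.\<close>

lemma rank_one_operatorE:
  assumes Z: "complex_vector.subspace Z" and T: "rank_one_operator Z T"
  obtains \<phi> v where "\<phi> \<in> dual Z" "v \<in> Z" "norm v = 1" "\<And>z. z \<in> Z \<Longrightarrow> T z = \<phi> z *\<^sub>C v"
    "\<exists>z\<in>Z. \<phi> z \<noteq> 0"
proof -
  have lin: "bounded_clinear_on Z T" and TZ: "T ` Z \<subseteq> Z" and dim: "complex_vector.dim (T ` Z) = 1"
    using T by (simp_all add: rank_one_operator_def)
  obtain B where B: "B \<subseteq> T ` Z" "complex_vector.independent B" "T ` Z \<subseteq> complex_vector.span B" "card B = 1"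
    using complex_vector.basis_exists[of "T ` Z"] dim by metis
  then obtain w where w: "B = {w}" by (metis card_1_singletonE)
  then have w0: "w \<noteq> 0" using B(2) complex_vector.dependent_zero by blast
  define v where "v = complex_of_real (1 / norm w) *\<^sub>C w"
  have v0: "v \<noteq> 0" using w0 by (simp add: v_def)
  have wv: "w = complex_of_real (norm w) *\<^sub>C v"
    using w0 by (simp add: v_def scaleC_scaleC scaleC_one flip: of_real_mult)
  have "\<exists>c. T z = c *\<^sub>C v" if "z \<in> Z" for z
  proof -
    have "T z \<in> complex_vector.span {w}" using B(3) w that by auto
    then obtain k where "T z = k *\<^sub>C w" unfolding complex_vector.span_singleton by blast
    then have "T z = (k * complex_of_real (norm w)) *\<^sub>C v" using wv by (metis scaleC_scaleC)
    then show ?thesis ..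
  qed
  then obtain \<phi> where \<phi>: "\<And>z. z \<in> Z \<Longrightarrow> T z = \<phi> z *\<^sub>C v" by metis
  show thesis
  proof (rule that)
    show nv: "norm v = 1" using w0 by (simp add: v_def norm_scaleC norm_divide)
    show "v \<in> Z" unfolding v_def using B(1) TZ w by (intro complex_vector.subspace_scale[OF Z]) auto
    show "T z = \<phi> z *\<^sub>C v" if "z \<in> Z" for z using \<phi>[OF that] .
    show "\<exists>z\<in>Z. \<phi> z \<noteq> 0" using B(1) w w0 \<phi> by fastforce
    show "\<phi> \<in> dual Z"
      unfolding dual_def mem_Collect_eq bounded_clinear_on_def
    proof (intro conjI ballI allI)
      fix x y assume xy: "x \<in> Z" "y \<in> Z"
      then have "\<phi> (x + y) *\<^sub>C v = (\<phi> x + \<phi> y) *\<^sub>C v"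
        using lin complex_vector.subspace_add[OF Z] unfolding bounded_clinear_on_def scaleC_add_left
        by (metis \<phi>)
      then show "\<phi> (x + y) = \<phi> x + \<phi> y" using v0 by simp
    next
      fix c x assume x: "x \<in> Z"
      then have "\<phi> (c *\<^sub>C x) *\<^sub>C v = (c * \<phi> x) *\<^sub>C v"
        using lin complex_vector.subspace_scale[OF Z] unfolding bounded_clinear_on_def
        by (metis \<phi> scaleC_scaleC)
      then show "\<phi> (c *\<^sub>C x) = c *\<^sub>C \<phi> x" using v0 by (simp add: scaleC_complex_def)
    next
      obtain C where C: "\<And>x. x \<in> Z \<Longrightarrow> norm (T x) \<le> C * norm x"
        using lin unfolding bounded_clinear_on_def by blast
      have "norm (\<phi> x) \<le> C * norm x" if "x \<in> Z" for x
        using C[OF that] \<phi>[OF that] nv by (simp add: norm_scaleC)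
      then show "\<exists>C. \<forall>x\<in>Z. norm (\<phi> x) \<le> C * norm x" by blast
    qed
  qed
qed

section \<open>From the Daugavet and diametral properties to property (D)\<close>

lemma daugavet_property_imp_property_D:
  assumes Z: "complex_vector.subspace Z" and D: "daugavet_property Z"
  shows "property_D Z"
  unfolding property_D_def
proof (intro allI impI, elim conjE)
  fix P assume P: "rank_one_operator Z P" "ball_norm Z P = 1"
  have "ball_norm Z (\<lambda>z. z + - P z) = 1 + ball_norm Z (\<lambda>z. - P z)"
    using D rank_one_operator_uminus[OF Z P(1)] unfolding daugavet_property_def by blast
  then show "ball_norm Z (\<lambda>z. z - P z) = 2" using P(2) by (simp add: ball_norm_def)
qed

lemma DD2P_imp_DLD2P:
  assumes "DD2P Z"
  shows "DLD2P Z"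
  unfolding DLD2P_def
proof (intro allI impI ballI)
  fix S x and \<epsilon> :: real assume S: "is_slice Z S" and x: "x \<in> S \<inter> unit_sphere Z" and \<epsilon>: "0 < \<epsilon>"
  obtain \<phi> e where \<phi>: "\<phi> \<in> dual Z" "S = {y \<in> unit_ball Z. Re (\<phi> y) > 1 - e}"
    using S unfolding is_slice_def by blast
  have "open {w. Re w > 1 - e}" by (intro open_Collect_less continuous_intros)
  then have "openin (weak_topology Z) {z \<in> Z. \<phi> z \<in> {w. Re w > 1 - e}}"
    unfolding weak_topology_def using \<phi>(1) by (intro topology_generated_by_Basis) blast
  moreover have "S = {z \<in> Z. \<phi> z \<in> {w. Re w > 1 - e}} \<inter> unit_ball Z"
    using \<phi>(2) by (auto simp: unit_ball_def)
  ultimately have "openin (subtopology (weak_topology Z) (unit_ball Z)) S"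
    unfolding openin_subtopology by blast
  then show "\<exists>y\<in>S. norm (x - y) \<ge> 2 - \<epsilon>"
    using assms x \<epsilon> unfolding DD2P_def by blast
qed

text \<open>Write P z = \<phi>(z) v. Then \<open>v\<close> lies in every slice given by \<phi>, and
  the slice contains some \<open>y\<close> almost at distance 2 from \<open>v\<close>. In a thin
  slice \<phi>(y) is close to 1, so \<open>P y\<close> is close to \<open>v\<close> and the norm of
  \<open>y - P y\<close> is almost 2.\<close>

lemma DLD2P_imp_property_D:
  assumes Z: "complex_vector.subspace Z" and D: "DLD2P Z"
  shows "property_D Z"
  unfolding property_D_def
proof (intro allI impI, elim conjE)
  fix P assume P: "rank_one_operator Z P" "\<forall>z\<in>Z. P (P z) = P z" "ball_norm Z P = 1"
  obtain \<phi> v where \<phi>: "\<phi> \<in> dual Z" and v: "v \<in> Z" "norm v = 1"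
    and Pz: "\<And>z. z \<in> Z \<Longrightarrow> P z = \<phi> z *\<^sub>C v" and nz: "\<exists>z\<in>Z. \<phi> z \<noteq> 0"
    using rank_one_operatorE[OF Z P(1)] by metis
  have v0: "v \<noteq> 0" using v by auto
  obtain z where z: "z \<in> Z" "\<phi> z \<noteq> 0" using nz by blast
  \<comment> \<open>Idempotence at a point \<open>z\<close> with \<phi>(z) nonzero shows that
    \<open>P\<close> fixes \<open>v\<close>, hence \<phi>(v) = 1.\<close>
  have "P (\<phi> z *\<^sub>C v) = \<phi> z *\<^sub>C P v"
    using P(1) v unfolding rank_one_operator_def bounded_clinear_on_def by blast
  then have "P (P z) = \<phi> z *\<^sub>C P v" using Pz[OF z(1)] by simp
  then have "\<phi> z *\<^sub>C P v = \<phi> z *\<^sub>C v" using P(2) z Pz by simp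
  then have "P v = v" using z(2) complex_vector.scale_left_imp_eq by blast
  then have "\<phi> v *\<^sub>C v = 1 *\<^sub>C v" using Pz[OF v(1)] by (simp only: scaleC_one)
  then have \<phi>v: "\<phi> v = 1" using v0 by (simp only: complex_vector.scale_cancel_right) simp
  have nP: "norm (P z) = cmod (\<phi> z)" if "z \<in> Z" for z using Pz[OF that] v by (simp add: norm_scaleC)
  have "ball_norm Z \<phi> = ball_norm Z P"
    unfolding ball_norm_def using nP by (intro SUP_cong) (auto simp: unit_ball_def)
  then have \<phi>1: "ball_norm Z \<phi> = 1" using P by simp
  have lin: "bounded_clinear_on Z \<phi>" using \<phi> by (simp add: dual_def)
  have \<phi>le: "cmod (\<phi> z) \<le> 1" if "z \<in> unit_ball Z" for z
    using bounded_clinear_on_unit_ball[OF lin] norm_le_ball_norm[of Z \<phi> _ z] that \<phi>1 by metis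
  have up: "norm (z - P z) \<le> 2" if "z \<in> unit_ball Z" for z
    using norm_triangle_ineq4[of z "P z"] nP[of z] \<phi>le[OF that] that by (auto simp: unit_ball_def)
  have low: "ball_norm Z (\<lambda>z. z - P z) \<ge> 2 - e - sqrt (2 * e)" if e: "0 < e" for e
  proof -
    let ?S = "{y \<in> unit_ball Z. Re (\<phi> y) > 1 - e}"
    have "is_slice Z ?S" unfolding is_slice_def using \<phi> \<phi>1 e by blast
    moreover have "v \<in> ?S \<inter> unit_sphere Z" using v \<phi>v e by (simp add: unit_ball_def unit_sphere_def)
    ultimately obtain y where y: "y \<in> ?S" "norm (v - y) \<ge> 2 - e"
      using D e unfolding DLD2P_def by blast
    have yZ: "y \<in> Z" using y by (simp add: unit_ball_def)
    have "(cmod (1 - \<phi> y))\<^sup>2 = 1 - 2 * Re (\<phi> y) + (cmod (\<phi> y))\<^sup>2"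
      unfolding cmod_power2 by (simp add: power2_eq_square algebra_simps)
    also have "\<dots> \<le> 2 * e"
      using y \<phi>le[of y] power_mono[of "cmod (\<phi> y)" 1 2] by simp
    finally have "cmod (1 - \<phi> y) \<le> sqrt (2 * e)" by (rule real_le_rsqrt)
    moreover have eq: "v - y = (1 - \<phi> y) *\<^sub>C v - (y - P y)"
      using Pz[OF yZ] by (simp add: complex_vector.scale_left_diff_distrib scaleC_one)
    then have "norm (v - y) \<le> cmod (1 - \<phi> y) + norm (y - P y)"
      using norm_triangle_ineq4[of "(1 - \<phi> y) *\<^sub>C v" "y - P y"]
      unfolding eq by (simp only: norm_scaleC v mult_1_right)
    moreover have "norm (y - P y) \<le> ball_norm Z (\<lambda>z. z - P z)"
      using y norm_le_ball_norm[of Z "\<lambda>z. z - P z"] up by blast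
    ultimately show ?thesis using y by linarith
  qed
  have "((\<lambda>e. 2 - e - sqrt (2 * e)) \<longlongrightarrow> 2 - 0 - sqrt (2 * 0)) (at_right 0)"
    by (intro tendsto_intros)
  moreover have "\<forall>\<^sub>F e in at_right 0. 2 - e - sqrt (2 * e) \<le> ball_norm Z (\<lambda>z. z - P z)"
    using low eventually_at_right_less[of "0::real"] by (auto elim: eventually_mono)
  ultimately have "ball_norm Z (\<lambda>z. z - P z) \<ge> 2 - 0 - sqrt (2 * 0)"
    by (intro tendsto_upperbound) auto
  moreover have "ball_norm Z (\<lambda>z. z - P z) \<le> 2" by (rule ball_norm_le[OF Z up])
  ultimately show "ball_norm Z (\<lambda>z. z - P z) = 2" by simp
qed

section \<open>Weak topology and weak compactness of rank-one operators\<close>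

lemma openin_weak_topology_basic:
  "\<phi> \<in> dual Z \<Longrightarrow> open U \<Longrightarrow> openin (weak_topology Z) {z \<in> Z. \<phi> z \<in> U}"
  unfolding weak_topology_def by (intro topology_generated_by_Basis) blast

lemma topspace_weak_topology: "topspace (weak_topology Z) = Z"
proof -
  have "(\<lambda>_. 0) \<in> dual Z" by (auto simp: dual_def bounded_clinear_on_def scaleC_complex_def intro!: exI[of _ 0])
  then have "openin (weak_topology Z) {z \<in> Z. 0 \<in> (UNIV :: complex set)}"
    by (rule openin_weak_topology_basic) simp
  then have "Z \<subseteq> topspace (weak_topology Z)" using openin_subset by fastforce
  moreover have "topspace (weak_topology Z) \<subseteq> Z"
    unfolding weak_topology_def topology_generated_by_topspace by blast
  ultimately show ?thesis by blast
qed

text \<open>The image of the unit ball lies in the multiples of \<open>v\<close> with coefficients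
  in a closed disc, a compact set. Since \<open>sep\<close> makes the weak topology Hausdorff, this
  set is closed and contains the weak closure of the image. For a uniform algebra \<open>sep\<close>
  comes from the point evaluations.\<close>

lemma rank_one_operator_weakly_compact:
  assumes Z: "complex_vector.subspace Z" and T: "rank_one_operator Z T"
    and sep: "\<And>x y. x \<in> Z \<Longrightarrow> y \<in> Z \<Longrightarrow> x \<noteq> y \<Longrightarrow> \<exists>\<phi>\<in>dual Z. \<phi> x \<noteq> \<phi> y"
  shows "weakly_compact_on Z T"
proof -
  obtain \<phi> v where \<phi>: "\<phi> \<in> dual Z" and v: "v \<in> Z" "norm v = 1"
    and Tz: "\<And>z. z \<in> Z \<Longrightarrow> T z = \<phi> z *\<^sub>C v"
    using rank_one_operatorE[OF Z T] by metis
  have "bounded_clinear_on Z T" using T by (simp add: rank_one_operator_def)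
  then obtain C where C: "\<And>z. z \<in> unit_ball Z \<Longrightarrow> norm (T z) \<le> C"
    using bounded_clinear_on_unit_ball by blast
  let ?K = "(\<lambda>c. c *\<^sub>C v) ` cball 0 C"
  have cont: "continuous_map euclidean (weak_topology Z) (\<lambda>c. c *\<^sub>C v)"
    unfolding weak_topology_def
  proof (rule continuous_on_generated_topo)
    fix U assume "U \<in> {{z \<in> Z. \<phi> z \<in> U} |\<phi> U. \<phi> \<in> dual Z \<and> open U}"
    then obtain \<psi> W where \<psi>: "U = {z \<in> Z. \<psi> z \<in> W}" "\<psi> \<in> dual Z" "open W" by blast
    have "(\<lambda>c. c *\<^sub>C v) -` U = {c. c * \<psi> v \<in> W}"
      using \<psi> v complex_vector.subspace_scale[OF Z]
      by (auto simp: dual_def bounded_clinear_on_def scaleC_complex_def)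
    moreover have "open {c. c * \<psi> v \<in> W}"
      using open_vimage[OF \<psi>(3), of "\<lambda>c. c * \<psi> v"] by (simp add: vimage_def continuous_intros)
    ultimately show "openin euclidean ((\<lambda>c. c *\<^sub>C v) -` U \<inter> topspace euclidean)" by simp
  next
    show "(\<lambda>c. c *\<^sub>C v) ` topspace euclidean \<subseteq> \<Union> {{z \<in> Z. \<phi> z \<in> U} |\<phi> U. \<phi> \<in> dual Z \<and> open U}"
      using topspace_weak_topology[of Z] v complex_vector.subspace_scale[OF Z]
      unfolding weak_topology_def topology_generated_by_topspace by auto
  qed
  have comp: "compactin (weak_topology Z) ?K"
    using image_compactin[OF _ cont, of "cball 0 C"] by simp
  have "Hausdorff_space (weak_topology Z)"
    unfolding Hausdorff_space_def topspace_weak_topology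
  proof (intro allI impI, elim conjE)
    fix x y assume xy: "x \<in> Z" "y \<in> Z" "x \<noteq> y"
    obtain \<psi> where \<psi>: "\<psi> \<in> dual Z" "\<psi> x \<noteq> \<psi> y" using sep[OF xy] by blast
    obtain U V where UV: "open U" "open V" "\<psi> x \<in> U" "\<psi> y \<in> V" "U \<inter> V = {}"
      using hausdorff[OF \<psi>(2)] by blast
    show "\<exists>U V. openin (weak_topology Z) U \<and> openin (weak_topology Z) V \<and> x \<in> U \<and> y \<in> V \<and> disjnt U V"
      using UV xy openin_weak_topology_basic[OF \<psi>(1)]
      by (intro exI[of _ "{z \<in> Z. \<psi> z \<in> U}"] exI[of _ "{z \<in> Z. \<psi> z \<in> V}"]) (auto simp: disjnt_def)
  qed
  then have closed: "closedin (weak_topology Z) ?K" using comp by (rule compactin_imp_closedin)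
  have "T ` unit_ball Z \<subseteq> ?K"
  proof
    fix y assume "y \<in> T ` unit_ball Z"
    then obtain z where z: "z \<in> unit_ball Z" "y = T z" by blast
    then have "y = \<phi> z *\<^sub>C v" "z \<in> Z" using Tz by (auto simp: unit_ball_def)
    moreover have "cmod (\<phi> z) \<le> C" using C[OF z(1)] Tz[OF \<open>z \<in> Z\<close>] v by (simp add: norm_scaleC)
    ultimately show "y \<in> ?K" by auto
  qed
  then have sub: "weak_topology Z closure_of (T ` unit_ball Z) \<subseteq> ?K"
    using closed by (rule closure_of_minimal)
  show ?thesis
    unfolding weakly_compact_on_def by (rule closed_compactin[OF comp sub closedin_closure_of])
qed

lemma polynomial_on_clinear:
  assumes "bounded_clinear_on Z T" "T ` Z \<subseteq> Z"
  shows "polynomial_on Z T"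
proof -
  have "bounded_multilinear_on Z 1 (\<lambda>xs. T (hd xs))"
    unfolding bounded_multilinear_on_def
  proof (intro conjI ballI impI allI)
    fix xs assume "xs \<in> lists Z" "length xs = 1"
    then show "T (hd xs) \<in> Z" using assms by (cases xs) auto
  next
    fix xs :: "'a list" and i x y
    assume "length xs = 1" "i < (1::nat)" "x \<in> Z" "y \<in> Z"
    then show "T (hd (xs[i := x + y])) = T (hd (xs[i := x])) + T (hd (xs[i := y]))"
      using assms by (cases xs) (auto simp: bounded_clinear_on_def)
  next
    fix xs :: "'a list" and i c x
    assume "length xs = 1" "i < (1::nat)" "x \<in> Z"
    then show "T (hd (xs[i := c *\<^sub>C x])) = c *\<^sub>C T (hd (xs[i := x]))"
      using assms by (cases xs) (auto simp: bounded_clinear_on_def)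
  next
    obtain C where C: "\<And>x. x \<in> Z \<Longrightarrow> norm (T x) \<le> C * norm x"
      using assms unfolding bounded_clinear_on_def by blast
    have "norm (T (hd xs)) \<le> C * prod_list (map norm xs)" if "xs \<in> lists Z" "length xs = 1" for xs
      using that C by (cases xs) auto
    then show "\<exists>C. \<forall>xs\<in>lists Z. length xs = 1 \<longrightarrow> norm (T (hd xs)) \<le> C * prod_list (map norm xs)"
      by blast
  qed
  then have "homogeneous_polynomial_on Z T"
    unfolding homogeneous_polynomial_on_def by (intro exI conjI) auto
  then show ?thesis
    unfolding polynomial_on_def by (intro exI[of _ 1] exI[of _ "\<lambda>_. T"]) auto
qed

lemma polynomial_daugavet_property_imp_daugavet_property:
  assumes Z: "complex_vector.subspace Z"
    and sep: "\<And>x y. x \<in> Z \<Longrightarrow> y \<in> Z \<Longrightarrow> x \<noteq> y \<Longrightarrow> \<exists>\<phi>\<in>dual Z. \<phi> x \<noteq> \<phi> y"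
    and P: "polynomial_daugavet_property Z"
  shows "daugavet_property Z"
  unfolding daugavet_property_def
proof (intro allI impI)
  fix T assume T: "rank_one_operator Z T"
  then have "polynomial_on Z T" by (simp add: rank_one_operator_def polynomial_on_clinear)
  then show "ball_norm Z (\<lambda>z. z + T z) = 1 + ball_norm Z T"
    using P rank_one_operator_weakly_compact[OF Z T sep]
    unfolding polynomial_daugavet_property_def by blast
qed

section \<open>Weak convergence and polynomials\<close>

text \<open>Induction over the generation of the weak topology from its subbasic sets, for which the
  claim is the convergence of a single functional.\<close>

lemma weakly_open_eventually:
  assumes T: "openin (weak_topology Z) T" and x: "x \<in> T" and y: "\<And>n. y n \<in> Z"
    and lim: "\<And>\<phi>. \<phi> \<in> dual Z \<Longrightarrow> ((\<lambda>n. \<phi> (y n)) \<longlongrightarrow> \<phi> x) F"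
  shows "\<forall>\<^sub>F n in F. y n \<in> T"
proof -
  have "generate_topology_on {{z \<in> Z. \<phi> z \<in> U} |\<phi> U. \<phi> \<in> dual Z \<and> open U} T"
    using T unfolding weak_topology_def openin_topology_generated_by_iff .
  then show ?thesis using x
  proof (induction T)
    case Empty
    then show ?case by simp
  next
    case (Int a b)
    then show ?case by (auto simp: eventually_conj)
  next
    case (UN K)
    then obtain k where k: "k \<in> K" "x \<in> k" by blast
    then have "\<forall>\<^sub>F n in F. y n \<in> k" using UN.IH by blast
    then show ?case by eventually_elim (use k in blast)
  next
    case (Basis s)
    then obtain \<phi> U where \<phi>: "s = {z \<in> Z. \<phi> z \<in> U}" "\<phi> \<in> dual Z" "open U" by blast
    then have "\<forall>\<^sub>F n in F. \<phi> (y n) \<in> U" using Basis by (intro topological_tendstoD[OF lim]) auto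
    then show ?case by eventually_elim (use \<phi> y in blast)
  qed
qed

text \<open>The closures of the tails have the finite intersection property inside \<open>K\<close>:
  finitely many of them share \<open>f m\<close> for any late \<open>m\<close>.\<close>

lemma compactin_cluster_point:
  assumes K: "compactin X K" and f: "\<And>n::nat. f n \<in> K"
  obtains g where "g \<in> K" "\<And>n. g \<in> X closure_of (f ` {n..})"
proof -
  have sub: "f ` {n..} \<subseteq> topspace X" for n using K f compactin_subset_topspace by blast
  let ?\<U> = "range (\<lambda>n. X closure_of (f ` {n..}))"
  have "K \<inter> \<Inter>\<F> \<noteq> {}" if F: "finite \<F>" "\<F> \<subseteq> ?\<U>" for \<F>
  proof -
    obtain I where I: "finite I" "\<F> = (\<lambda>n. X closure_of (f ` {n..})) ` I"
      using finite_subset_image[OF F] by blast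
    obtain m where m: "\<And>i. i \<in> I \<Longrightarrow> i \<le> m" using I(1) by (meson finite_nat_set_iff_bounded_le)
    have "f m \<in> X closure_of (f ` {i..})" if "i \<in> I" for i
      using closure_of_subset[OF sub[of i]] m[OF that] by blast
    then show ?thesis using I(2) f[of m] by blast
  qed
  then have "K \<inter> \<Inter>?\<U> \<noteq> {}"
    using K unfolding compactin_fip by (metis (no_types, lifting) closedin_closure_of imageE)
  then show thesis using that by blast
qed

section \<open>Scalar polynomials and their sums\<close>

lemma dual_scalar_polynomial_on:
  assumes "\<phi> \<in> dual Z" "complex_vector.subspace Z"
  shows "scalar_polynomial_on Z \<phi>"
  unfolding scalar_polynomial_on_def
proof (intro conjI allI)
  have eq: "\<phi> (x + l *\<^sub>C u) = (\<Sum>i\<le>1. (if i = 0 then \<phi> x else \<phi> u) * l ^ i)" if "x \<in> Z" "u \<in> Z" for x u l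
    using assms that complex_vector.subspace_scale[OF assms(2)]
    by (simp add: dual_def bounded_clinear_on_def scaleC_complex_def)
  show "\<exists>d. \<forall>x\<in>Z. \<forall>u\<in>Z. \<exists>c. \<forall>l. \<phi> (x + l *\<^sub>C u) = (\<Sum>i\<le>d. c i * l ^ i)"
    by (intro exI[of _ 1] ballI exI allI) (rule eq)
next
  fix R
  obtain C where C: "\<And>x. x \<in> Z \<Longrightarrow> cmod (\<phi> x) \<le> C * norm x"
    using assms unfolding dual_def bounded_clinear_on_def by blast
  have "cmod (\<phi> x) \<le> \<bar>C\<bar> * R" if "x \<in> Z" "norm x \<le> R" for x
  proof -
    have "C * norm x \<le> \<bar>C\<bar> * R" using that by (intro mult_mono) auto
    then show ?thesis using C[OF that(1)] by simp
  qed
  then show "\<exists>B. \<forall>x\<in>Z. norm x \<le> R \<longrightarrow> cmod (\<phi> x) \<le> B" by blast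
qed

lemma scalar_polynomial_on_add:
  assumes "scalar_polynomial_on Z \<Phi>" "scalar_polynomial_on Z \<Psi>"
  shows "scalar_polynomial_on Z (\<lambda>x. \<Phi> x + \<Psi> x)"
proof -
  obtain d where d: "\<And>x u. x \<in> Z \<Longrightarrow> u \<in> Z \<Longrightarrow> \<exists>c. \<forall>l. \<Phi> (x + l *\<^sub>C u) = (\<Sum>i\<le>d. c i * l ^ i)"
    using assms(1) unfolding scalar_polynomial_on_def by blast
  obtain d' where d': "\<And>x u. x \<in> Z \<Longrightarrow> u \<in> Z \<Longrightarrow> \<exists>c. \<forall>l. \<Psi> (x + l *\<^sub>C u) = (\<Sum>i\<le>d'. c i * l ^ i)"
    using assms(2) unfolding scalar_polynomial_on_def by blast
  have pad: "(\<Sum>i\<le>n. c i * l ^ i) = (\<Sum>i\<le>m. (if i \<le> n then c i else 0) * l ^ i)"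
    if "n \<le> m" for n m and c :: "nat \<Rightarrow> complex" and l
    using that by (intro sum.mono_neutral_cong_left) auto
  show ?thesis
    unfolding scalar_polynomial_on_def
  proof (intro conjI allI)
    show "\<exists>d. \<forall>x\<in>Z. \<forall>u\<in>Z. \<exists>c. \<forall>l. \<Phi> (x + l *\<^sub>C u) + \<Psi> (x + l *\<^sub>C u) = (\<Sum>i\<le>d. c i * l ^ i)"
    proof (intro exI[of _ "max d d'"] ballI)
      fix x u assume xu: "x \<in> Z" "u \<in> Z"
      obtain c c' where c: "\<And>l. \<Phi> (x + l *\<^sub>C u) = (\<Sum>i\<le>d. c i * l ^ i)"
        "\<And>l. \<Psi> (x + l *\<^sub>C u) = (\<Sum>i\<le>d'. c' i * l ^ i)"
        using d[OF xu] d'[OF xu] by blast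
      have eq: "\<Phi> (x + l *\<^sub>C u) + \<Psi> (x + l *\<^sub>C u) =
        (\<Sum>i\<le>max d d'. ((if i \<le> d then c i else 0) + (if i \<le> d' then c' i else 0)) * l ^ i)" for l
        unfolding c pad[OF max.cobounded1[of d d']] pad[OF max.cobounded2[of d' d]]
          distrib_right sum.distrib ..
      show "\<exists>c. \<forall>l. \<Phi> (x + l *\<^sub>C u) + \<Psi> (x + l *\<^sub>C u) = (\<Sum>i\<le>max d d'. c i * l ^ i)"
        by (intro exI allI) (rule eq)
    qed
    fix R
    obtain B B' where "\<forall>x\<in>Z. norm x \<le> R \<longrightarrow> cmod (\<Phi> x) \<le> B" "\<forall>x\<in>Z. norm x \<le> R \<longrightarrow> cmod (\<Psi> x) \<le> B'"
      using assms unfolding scalar_polynomial_on_def by blast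
    then have "\<forall>x\<in>Z. norm x \<le> R \<longrightarrow> cmod (\<Phi> x + \<Psi> x) \<le> B + B'"
      by (auto intro: norm_triangle_mono)
    then show "\<exists>B. \<forall>x\<in>Z. norm x \<le> R \<longrightarrow> cmod (\<Phi> x + \<Psi> x) \<le> B" by blast
  qed
qed

lemma scalar_polynomial_on_zero: "scalar_polynomial_on Z (\<lambda>_. 0)"
proof -
  have "\<forall>x\<in>Z. \<forall>u\<in>Z. \<exists>c. \<forall>l. (0::complex) = (\<Sum>i\<le>0. c i * l ^ i)"
    by (intro ballI exI[of _ "\<lambda>_. 0"]) simp
  then show ?thesis unfolding scalar_polynomial_on_def by (auto intro!: exI[of _ 0])
qed

lemma scalar_polynomial_on_sum:
  fixes n :: nat
  assumes "\<And>i. i < n \<Longrightarrow> scalar_polynomial_on Z (\<Phi> i)"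
  shows "scalar_polynomial_on Z (\<lambda>x. \<Sum>i<n. \<Phi> i x)"
  using assms by (induction n) (simp_all add: scalar_polynomial_on_zero scalar_polynomial_on_add)

lemma scalar_polynomial_on_cong:
  assumes "scalar_polynomial_on Z \<Phi>" "complex_vector.subspace Z" "\<And>x. x \<in> Z \<Longrightarrow> \<Psi> x = \<Phi> x"
  shows "scalar_polynomial_on Z \<Psi>"
proof -
  have "x + l *\<^sub>C u \<in> Z" if "x \<in> Z" "u \<in> Z" for x u l
    using that by (intro complex_vector.subspace_add complex_vector.subspace_scale assms(2))
  then show ?thesis using assms(1,3) unfolding scalar_polynomial_on_def by simp
qed

text \<open>Induction on the number \<open>j\<close> of slots still holding x + l u, with the slots
  already expanded collected in \<open>xs\<close>. Expanding the first remaining slot gives one term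
  with \<open>x\<close> and one with \<open>u\<close>; the latter carries a factor \<open>l\<close>,
  which shifts its coefficients by one.\<close>

lemma multilinear_along_line:
  assumes F: "bounded_multilinear_on Z k F" and Z: "complex_vector.subspace Z" and xu: "x \<in> Z" "u \<in> Z"
    and xs: "xs \<in> lists Z" "length xs + j = k"
  shows "\<exists>c. \<forall>l. F (xs @ replicate j (x + l *\<^sub>C u)) = (\<Sum>i\<le>j. (l ^ i) *\<^sub>C c i)"
  using xs
proof (induction j arbitrary: xs)
  case 0
  show ?case by (intro exI[of _ "\<lambda>_. F xs"]) (simp add: scaleC_one)
next
  case (Suc j)
  obtain c where c: "\<And>l. F ((xs @ [x]) @ replicate j (x + l *\<^sub>C u)) = (\<Sum>i\<le>j. (l ^ i) *\<^sub>C c i)"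
    using Suc.IH[of "xs @ [x]"] Suc.prems xu by auto
  obtain c' where c': "\<And>l. F ((xs @ [u]) @ replicate j (x + l *\<^sub>C u)) = (\<Sum>i\<le>j. (l ^ i) *\<^sub>C c' i)"
    using Suc.IH[of "xs @ [u]"] Suc.prems xu by auto
  have eq: "F (xs @ replicate (Suc j) (x + l *\<^sub>C u)) =
    (\<Sum>i\<le>Suc j. (l ^ i) *\<^sub>C ((if i \<le> j then c i else 0) + (if i = 0 then 0 else c' (i - 1))))" for l
  proof -
    let ?z = "x + l *\<^sub>C u" and ?n = "length xs"
    let ?L = "xs @ ?z # replicate j ?z"
    have lu: "l *\<^sub>C u \<in> Z" using xu Z by (simp add: complex_vector.subspace_scale)
    then have zZ: "?z \<in> Z" using xu Z by (simp add: complex_vector.subspace_add)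
    have L: "?L \<in> lists Z" "length ?L = k" "?n < k" using Suc.prems zZ by auto
    have upd: "?L[?n := w] = xs @ w # replicate j ?z" for w by simp
    have add: "F (?L[?n := a + b]) = F (?L[?n := a]) + F (?L[?n := b])" if "a \<in> Z" "b \<in> Z" for a b
      using F L that unfolding bounded_multilinear_on_def by blast
    have scale: "F (?L[?n := c *\<^sub>C a]) = c *\<^sub>C F (?L[?n := a])" if "a \<in> Z" for a c
      using F L that unfolding bounded_multilinear_on_def by blast
    have "F ?L = F (xs @ x # replicate j ?z) + l *\<^sub>C F (xs @ u # replicate j ?z)"
      using add[OF xu(1) lu] scale[OF xu(2), of l] unfolding upd by simp
    also have "\<dots> = (\<Sum>i\<le>j. (l ^ i) *\<^sub>C c i) + l *\<^sub>C (\<Sum>i\<le>j. (l ^ i) *\<^sub>C c' i)"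
      using c[of l] c'[of l] by simp
    also have "(\<Sum>i\<le>j. (l ^ i) *\<^sub>C c i) = (\<Sum>i\<le>Suc j. (l ^ i) *\<^sub>C (if i \<le> j then c i else 0))"
      by (intro sum.mono_neutral_cong_left) auto
    also have "l *\<^sub>C (\<Sum>i\<le>j. (l ^ i) *\<^sub>C c' i) = (\<Sum>i\<le>j. (l ^ Suc i) *\<^sub>C c' i)"
      by (simp add: complex_vector.scale_sum_right scaleC_scaleC)
    also have "\<dots> = (\<Sum>i\<le>Suc j. (l ^ i) *\<^sub>C (if i = 0 then 0 else c' (i - 1)))"
      by (subst sum.atMost_Suc_shift) simp
    finally show ?thesis by (simp only: scaleC_add_right sum.distrib replicate_Suc)
  qed
  show ?case by (intro exI allI) (rule eq)
qed

section \<open>Bounds, range and point values of polynomials\<close>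

lemma replicate_in_lists: "z \<in> Z \<Longrightarrow> replicate k z \<in> lists Z"
  by (auto simp: in_lists_conv_set)

lemma homogeneous_polynomial_on_bounded:
  assumes "homogeneous_polynomial_on Z Q"
  shows "\<exists>B. \<forall>z\<in>Z. norm z \<le> R \<longrightarrow> norm (Q z) \<le> B"
proof -
  obtain k F C where F: "\<And>z. z \<in> Z \<Longrightarrow> Q z = F (replicate k z)"
    and C: "\<And>xs. xs \<in> lists Z \<Longrightarrow> length xs = k \<Longrightarrow> norm (F xs) \<le> C * prod_list (map norm xs)"
    using assms unfolding homogeneous_polynomial_on_def bounded_multilinear_on_def by metis
  have "norm (Q z) \<le> \<bar>C\<bar> * R ^ k" if "z \<in> Z" "norm z \<le> R" for z
  proof -
    have "norm (Q z) \<le> C * norm z ^ k"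
      using C[OF replicate_in_lists[OF that(1)]] F[OF that(1)] by simp
    also have "\<dots> \<le> \<bar>C\<bar> * R ^ k" using that by (intro mult_mono power_mono) auto
    finally show ?thesis .
  qed
  then show ?thesis by blast
qed

lemma homogeneous_polynomial_on_maps:
  assumes "homogeneous_polynomial_on Z Q" "z \<in> Z"
  shows "Q z \<in> Z"
proof -
  obtain k F where F: "bounded_multilinear_on Z k F" "Q z = F (replicate k z)"
    using assms unfolding homogeneous_polynomial_on_def by blast
  then show ?thesis
    using replicate_in_lists[OF assms(2), of k] by (simp add: bounded_multilinear_on_def)
qed

lemma polynomial_on_bounded:
  assumes "polynomial_on Z P"
  obtains B where "\<And>z. z \<in> Z \<Longrightarrow> norm z \<le> R \<Longrightarrow> norm (P z) \<le> B"
proof -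
  obtain n Q where Q: "\<And>i. i < n \<Longrightarrow> homogeneous_polynomial_on Z (Q i)" "\<And>z. z \<in> Z \<Longrightarrow> P z = (\<Sum>i<(n::nat). Q i z)"
    using assms unfolding polynomial_on_def by blast
  have "\<forall>i. \<exists>B. i < n \<longrightarrow> (\<forall>z\<in>Z. norm z \<le> R \<longrightarrow> norm (Q i z) \<le> B)"
    using homogeneous_polynomial_on_bounded[OF Q(1)] by blast
  then obtain B where B: "\<And>i z. i < n \<Longrightarrow> z \<in> Z \<Longrightarrow> norm z \<le> R \<Longrightarrow> norm (Q i z) \<le> B i" by metis
  show thesis
    by (rule that[of "\<Sum>i<n. B i"]) (auto simp: Q(2) intro!: sum_norm_le B)
qed

lemma polynomial_on_maps:
  assumes "polynomial_on Z P" "complex_vector.subspace Z" "z \<in> Z"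
  shows "P z \<in> Z"
proof -
  obtain n Q where Q: "\<And>i. i < n \<Longrightarrow> homogeneous_polynomial_on Z (Q i)" "\<And>z. z \<in> Z \<Longrightarrow> P z = (\<Sum>i<(n::nat). Q i z)"
    using assms(1) unfolding polynomial_on_def by blast
  show ?thesis
    unfolding Q(2)[OF assms(3)] using homogeneous_polynomial_on_maps[OF Q(1) assms(3)]
    by (intro complex_vector.subspace_sum[OF assms(2)]) simp
qed

lemma apply_sum_bcontfun: "apply_bcontfun (\<Sum>i\<in>I. f i) t = (\<Sum>i\<in>I. apply_bcontfun (f i) t)"
  by (induction I rule: infinite_finite_induct) simp_all

text \<open>This makes the convergence in \<open>spike_sequence\<close> applicable to the values of
  \<open>P\<close> at a fixed point. Along a line, the coefficients are the values at
  \<open>t\<close> of the vectors from \<open>multilinear_along_line\<close>.\<close>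

lemma polynomial_on_eval:
  fixes Z :: "('k::topological_space \<Rightarrow>\<^sub>C complex) set"
  assumes P: "polynomial_on Z P" and Z: "complex_vector.subspace Z"
  shows "scalar_polynomial_on Z (\<lambda>z. apply_bcontfun (P z) t)"
proof -
  obtain n Q where Q: "\<And>i. i < n \<Longrightarrow> homogeneous_polynomial_on Z (Q i)" "\<And>z. z \<in> Z \<Longrightarrow> P z = (\<Sum>i<(n::nat). Q i z)"
    using P unfolding polynomial_on_def by blast
  have "scalar_polynomial_on Z (\<lambda>z. apply_bcontfun (Q i z) t)" if i: "i < n" for i
    unfolding scalar_polynomial_on_def
  proof (intro conjI allI)
    obtain k F where F: "bounded_multilinear_on Z k F" "\<And>z. z \<in> Z \<Longrightarrow> Q i z = F (replicate k z)"
      using Q(1)[OF i] unfolding homogeneous_polynomial_on_def by blast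
    show "\<exists>d. \<forall>x\<in>Z. \<forall>u\<in>Z. \<exists>c. \<forall>l. apply_bcontfun (Q i (x + l *\<^sub>C u)) t = (\<Sum>i\<le>d. c i * l ^ i)"
    proof (intro exI[of _ k] ballI)
      fix x u assume xu: "x \<in> Z" "u \<in> Z"
      obtain c where c: "\<And>l. F ([] @ replicate k (x + l *\<^sub>C u)) = (\<Sum>i\<le>k. (l ^ i) *\<^sub>C c i)"
        using multilinear_along_line[OF F(1) Z xu, of "[]" k] by auto
      have "x + l *\<^sub>C u \<in> Z" for l
        using xu by (intro complex_vector.subspace_add complex_vector.subspace_scale Z)
      then have eq: "apply_bcontfun (Q i (x + l *\<^sub>C u)) t = (\<Sum>i\<le>k. apply_bcontfun (c i) t * l ^ i)" for l
        using c[of l] by (simp add: F(2) apply_sum_bcontfun apply_scaleC_bcontfun scaleC_complex_def mult.commute)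
      show "\<exists>c. \<forall>l. apply_bcontfun (Q i (x + l *\<^sub>C u)) t = (\<Sum>i\<le>k. c i * l ^ i)"
        by (intro exI allI) (rule eq)
    qed
    fix R
    obtain B where "\<forall>z\<in>Z. norm z \<le> R \<longrightarrow> norm (Q i z) \<le> B"
      using homogeneous_polynomial_on_bounded[OF Q(1)[OF i]] by blast
    then show "\<exists>B. \<forall>x\<in>Z. norm x \<le> R \<longrightarrow> cmod (apply_bcontfun (Q i x) t) \<le> B"
      by (meson norm_bounded order_trans)
  qed
  then have "scalar_polynomial_on Z (\<lambda>z. \<Sum>i<n. apply_bcontfun (Q i z) t)" by (rule scalar_polynomial_on_sum)
  then show ?thesis using Z by (rule scalar_polynomial_on_cong) (simp add: Q(2) apply_sum_bcontfun)
qed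

section \<open>The implications for uniform algebras\<close>

context uniform_alg
begin

lemma eval_dual: "(\<lambda>f. apply_bcontfun f t) \<in> dual A"
  unfolding dual_def bounded_clinear_on_def
  by (auto intro!: exI[of _ 1] norm_bounded)

lemma dual_separates:
  assumes "f \<noteq> g"
  shows "\<exists>\<phi>\<in>dual A. \<phi> f \<noteq> \<phi> g"
proof -
  obtain t where "apply_bcontfun f t \<noteq> apply_bcontfun g t" using assms bcontfun_eqI by blast
  then show ?thesis by (intro bexI[OF _ eval_dual])
qed

lemma property_D_imp_not_isolated:
  assumes D: "property_D A"
  shows "\<not> t isolated_in shilov"
proof
  assume "t isolated_in shilov"
  then obtain T where T: "open T" "T \<inter> shilov = {t}" unfolding isolated_in_def by blast
  have ne: "T \<inter> shilov \<noteq> {}" using T by simp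
  obtain h s where h: "h \<in> A" "s \<in> T \<inter> shilov" "norm h \<le> 1" "apply_bcontfun h s = 1"
    "\<And>s. s \<in> shilov - T \<Longrightarrow> cmod (apply_bcontfun h s) \<le> 1/2"
    using peak_point[OF T(1) ne half_gt_zero[OF zero_less_one]] by metis
  have st: "s = t" using h(2) T by blast
  define P where "P f = apply_bcontfun f t *\<^sub>C h" for f
  have h0: "h \<noteq> 0" using h(4) by auto
  have bnd: "norm (P f) \<le> 1 * norm f" for f
    unfolding P_def norm_scaleC using norm_bounded[of f t] h(3)
    by (metis mult.commute mult_mono norm_ge_zero)
  have lin: "bounded_clinear_on A P"
    unfolding bounded_clinear_on_def
  proof (intro conjI ballI allI)
    show "\<exists>C. \<forall>x\<in>A. norm (P x) \<le> C * norm x" using bnd by blast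
  qed (simp_all add: P_def scaleC_add_left scaleC_scaleC)
  have PA: "P ` A = complex_vector.span {h}"
  proof (intro equalityI subsetI)
    fix y assume "y \<in> P ` A"
    then show "y \<in> complex_vector.span {h}" unfolding complex_vector.span_singleton P_def by blast
  next
    fix y assume "y \<in> complex_vector.span {h}"
    then obtain k where "y = k *\<^sub>C h" unfolding complex_vector.span_singleton by blast
    then have "y = P (const_bcontfun k)" by (simp add: P_def)
    then show "y \<in> P ` A" using const_mem by blast
  qed
  have "complex_vector.dim (P ` A) = 1"
    unfolding PA complex_vector.dim_span
    using complex_vector.dim_eq_card_independent[of "{h}"] h0 by simp
  moreover have "P ` A \<subseteq> A" using h(1) scaleC_mem by (auto simp: P_def)
  ultimately have r1: "rank_one_operator A P" using lin by (simp add: rank_one_operator_def)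
  have idem: "P (P f) = P f" for f using h(4) st by (simp add: P_def scaleC_scaleC)
  have Ph: "P h = h" using h(4) st by (simp add: P_def scaleC_one)
  have nh: "norm h = 1" using h(3,4) norm_bounded[of h s] by simp
  have "ball_norm A P \<le> 1"
    by (rule ball_norm_le[OF subspace]) (use bnd in \<open>auto simp: unit_ball_def intro: order_trans\<close>)
  moreover have "norm (P h) \<le> ball_norm A P"
    by (rule norm_le_ball_norm[where c = 1])
      (use bnd h nh in \<open>auto simp: unit_ball_def intro: order_trans\<close>)
  ultimately have "ball_norm A P = 1" using Ph nh by simp
  then have two: "ball_norm A (\<lambda>f. f - P f) = 2"
    using D r1 idem unfolding property_D_def by blast
  \<comment> \<open>On \<open>shilov\<close> the difference vanishes at \<open>t\<close> and has
    modulus at most 1 + 1/2 elsewhere, which contradicts the value 2.\<close>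
  have "ball_norm A (\<lambda>f. f - P f) \<le> 3/2"
  proof (rule ball_norm_le[OF subspace])
    fix f assume f: "f \<in> unit_ball A"
    then have fA: "f \<in> A" and f1: "cmod (apply_bcontfun f x) \<le> 1" for x
      using norm_bounded[of f x] by (auto simp: unit_ball_def)
    show "norm (f - P f) \<le> 3/2"
    proof (rule norm_le_shilov)
      show "f - P f \<in> A" using fA h(1) by (auto simp: P_def intro: diff_mem scaleC_mem)
      fix x assume x: "x \<in> shilov"
      show "cmod (apply_bcontfun (f - P f) x) \<le> 3/2"
      proof (cases "x = t")
        case True
        then show ?thesis using h(4) st by (simp add: P_def)
      next
        case False
        then have "cmod (apply_bcontfun h x) \<le> 1/2" using h(5)[of x] x T by blast
        then have "cmod (apply_bcontfun f t * apply_bcontfun h x) \<le> 1 * (1/2)"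
          unfolding norm_mult using f1[of t] by (intro mult_mono) auto
        then show ?thesis
          using f1[of x] norm_triangle_ineq4[of "apply_bcontfun f x" "apply_bcontfun f t * apply_bcontfun h x"]
          by (simp add: P_def)
      qed
    qed
  qed
  then show False using two by simp
qed

text \<open>One direction of Grothendieck's double limit criterion; pointwise cluster points suffice.\<close>

lemma weakly_compact_on_double_limit:
  assumes wc: "weakly_compact_on A P" and P: "\<And>f. f \<in> A \<Longrightarrow> P f \<in> A"
    and s: "\<And>n::nat. s n \<in> unit_ball A"
    and low: "\<And>j n. j \<le> n \<Longrightarrow> c \<le> Re (w * apply_bcontfun (P (s j)) (t n))"
    and high: "\<And>j n. n < j \<Longrightarrow> Re (w * apply_bcontfun (P (s j)) (t n)) \<le> c'"
  shows "c \<le> c'"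
proof -
  let ?W = "weak_topology A"
  have "P ` unit_ball A \<subseteq> topspace ?W" using P by (auto simp: topspace_weak_topology unit_ball_def)
  then have "P (s n) \<in> ?W closure_of (P ` unit_ball A)" for n using closure_of_subset s by blast
  then obtain g where g: "g \<in> ?W closure_of (P ` unit_ball A)" "\<And>n. g \<in> ?W closure_of ((\<lambda>n. P (s n)) ` {n..})"
    using compactin_cluster_point[of ?W "?W closure_of (P ` unit_ball A)" "\<lambda>n. P (s n)"] wc
    unfolding weakly_compact_on_def by blast
  \<comment> \<open>\<open>g\<close> is a weak cluster point of the \<open>P (s n)\<close> and
    \<open>u\<close> a cluster point of the \<open>t n\<close>; the real part of w g(u) is compared
    with both bounds.\<close>
  obtain u where u: "\<And>n. u \<in> closure (t ` {n..})"
    using compactin_cluster_point[of euclidean UNIV t] compact_UNIV by auto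
  have sA: "P (s n) \<in> A" for n using P s by (auto simp: unit_ball_def)
  have closedW: "closedin ?W {f \<in> A. Re (w * apply_bcontfun f x) \<in> C}" if "closed C" for x and C :: "real set"
  proof -
    have "open {z. Re (w * z) \<in> - C}"
      using open_vimage[of "- C" "\<lambda>z. Re (w * z)"] that
      by (simp add: open_Compl vimage_def continuous_intros)
    from openin_weak_topology_basic[OF eval_dual this, of x]
    have "openin ?W {f \<in> A. Re (w * apply_bcontfun f x) \<in> - C}" by simp
    moreover have "{f \<in> A. Re (w * apply_bcontfun f x) \<in> - C} = topspace ?W - {f \<in> A. Re (w * apply_bcontfun f x) \<in> C}"
      by (auto simp: topspace_weak_topology)
    ultimately show ?thesis unfolding closedin_def by (auto simp: topspace_weak_topology)
  qed
  \<comment> \<open>For fixed \<open>n\<close> the tail from \<open>Suc n\<close> on satisfies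
    \<open>high\<close>, so the bound passes to \<open>g\<close>, and then from the
    \<open>t n\<close> to \<open>u\<close>.\<close>
  have "Re (w * apply_bcontfun g (t n)) \<le> c'" for n
  proof -
    have "?W closure_of ((\<lambda>n. P (s n)) ` {Suc n..}) \<subseteq> {f \<in> A. Re (w * apply_bcontfun f (t n)) \<in> {..c'}}"
      by (rule closure_of_minimal[OF _ closedW]) (use high sA in auto)
    then show ?thesis using g(2)[of "Suc n"] by blast
  qed
  moreover have "closure (t ` {0..}) \<subseteq> {x. Re (w * apply_bcontfun g x) \<le> c'}"
    using calculation by (intro closure_minimal closed_Collect_le continuous_intros continuous_on_apply_bcontfun) auto
  ultimately have gu: "Re (w * apply_bcontfun g u) \<le> c'" using u[of 0] by blast
  \<comment> \<open>The other order: for fixed \<open>j\<close> the points from \<open>t j\<close>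
    on satisfy \<open>low\<close>, so the bound passes to \<open>u\<close>, and then from the
    \<open>P (s j)\<close> to \<open>g\<close>.\<close>
  have "c \<le> Re (w * apply_bcontfun (P (s j)) u)" for j
  proof -
    have "closure (t ` {j..}) \<subseteq> {x. c \<le> Re (w * apply_bcontfun (P (s j)) x)}"
      using low by (intro closure_minimal closed_Collect_le continuous_intros continuous_on_apply_bcontfun) auto
    then show ?thesis using u[of j] by blast
  qed
  then have "?W closure_of ((\<lambda>n. P (s n)) ` {0..}) \<subseteq> {f \<in> A. Re (w * apply_bcontfun f u) \<in> {c..}}"
    by (intro closure_of_minimal[OF _ closedW]) (use sA in auto)
  then show ?thesis using g(2)[of 0] gu by auto
qed

end

section \<open>Consequences of a Shilov boundary without isolated points\<close>

context perfect_uniform_alg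
begin

text \<open>First \<open>x\<close> is shrunk to r x of norm below 1, still in the weakly open set.
  At points where \<open>x\<close> is nearly x(t0), of modulus 1, spikes change the value to - r
  x(t0), so the distance to \<open>x\<close> is almost 1 + r. The resulting \<open>y k\<close>
  converge weakly to r x, so some \<open>y k\<close> lies in the set.\<close>

lemma DD2P: "DD2P A"
  unfolding DD2P_def
proof (intro allI impI ballI, elim conjE)
  fix W x and \<epsilon> :: real
  assume W: "openin (subtopology (weak_topology A) (unit_ball A)) W" and x: "x \<in> W \<inter> unit_sphere A" and \<epsilon>: "0 < \<epsilon>"
  obtain T where T: "openin (weak_topology A) T" "W = T \<inter> unit_ball A"
    using W unfolding openin_subtopology by blast
  have xA: "x \<in> A" "norm x = 1" using x by (auto simp: unit_sphere_def)
  define r where "r n = 1 - inverse (real (Suc n))" for n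
  have r: "r \<longlonglongrightarrow> 1" unfolding r_def using tendsto_diff[OF tendsto_const LIMSEQ_inverse_real_of_nat] by fastforce
  have "\<forall>\<^sub>F n in sequentially. of_real (r n) *\<^sub>C x \<in> T"
  proof (rule weakly_open_eventually[OF T(1)])
    show "x \<in> T" using x T by blast
    show "of_real (r n) *\<^sub>C x \<in> A" for n using xA by (intro scaleC_mem)
    fix \<phi> assume \<phi>: "\<phi> \<in> dual A"
    have "(\<lambda>n. of_real (r n) * \<phi> x) \<longlonglongrightarrow> of_real 1 * \<phi> x" by (intro tendsto_intros r)
    then show "(\<lambda>n. \<phi> (of_real (r n) *\<^sub>C x)) \<longlonglongrightarrow> \<phi> x"
      using \<phi> xA by (simp add: dual_def bounded_clinear_on_def)
  qed
  moreover have "\<forall>\<^sub>F n in sequentially. 1 - \<epsilon> / 2 < r n" using \<epsilon> by (intro order_tendstoD(1)[OF r]) simp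
  ultimately have "\<forall>\<^sub>F n in sequentially. of_real (r n) *\<^sub>C x \<in> T \<and> 1 - \<epsilon> / 2 < r n" by (rule eventually_conj)
  then obtain n where n: "of_real (r n) *\<^sub>C x \<in> T" "1 - \<epsilon> / 2 < r n"
    by (auto simp: eventually_sequentially)
  have r01: "0 \<le> r n" "r n < 1" unfolding r_def by (simp_all add: field_simps)
  obtain t0 where t0: "t0 \<in> shilov" "cmod (apply_bcontfun x t0) = 1"
    using is_boundary_shilov xA unfolding is_boundary_def by metis
  let ?s = "of_real (r n) *\<^sub>C x" and ?b = "- of_real (r n) * apply_bcontfun x t0"
  let ?V = "{t. cmod (apply_bcontfun x t - apply_bcontfun x t0) < \<epsilon> / 2}"
  have s: "?s \<in> A" "norm ?s < 1" using xA r01 by (auto simp: norm_scaleC intro: scaleC_mem)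
  have b: "cmod ?b < 1" using t0 r01 by (simp add: norm_mult)
  have "t0 \<in> ?V \<inter> shilov" using t0 \<epsilon> by simp
  then have V: "open ?V" "?V \<inter> shilov \<noteq> {}" using norm_level_sets(5) by blast+
  \<comment> \<open>No values are to be preserved, hence the empty set for \<open>F\<close> and an
    arbitrary \<open>d = 1\<close>.\<close>
  obtain y t where y: "\<And>k. y k \<in> A" "\<And>k. norm (y k) < 1" "\<And>k. t k \<in> ?V \<inter> shilov"
    "\<And>k. apply_bcontfun (y k) (t k) = ?b"
    and lim: "\<And>\<Phi>. scalar_polynomial_on A \<Phi> \<Longrightarrow> (\<lambda>k. \<Phi> (y k)) \<longlonglongrightarrow> \<Phi> ?s"
    using spike_sequence[OF s b V, of "{}" 1] by auto
  have "\<forall>\<^sub>F k in sequentially. y k \<in> T"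
    by (rule weakly_open_eventually[OF T(1) n(1) y(1)])
      (intro lim dual_scalar_polynomial_on subspace)
  then obtain k where k: "y k \<in> T" by (auto simp: eventually_sequentially)
  then have "y k \<in> W" using T(2) y(1)[of k] less_imp_le[OF y(2)[of k]] by (simp add: unit_ball_def)
  moreover have "2 - \<epsilon> \<le> norm (x - y k)"
  proof -
    have "(1 + of_real (r n)) * apply_bcontfun x t0 =
        apply_bcontfun (x - y k) (t k) - (apply_bcontfun x (t k) - apply_bcontfun x t0)"
      by (simp add: y(4) algebra_simps)
    then have "cmod ((1 + of_real (r n)) * apply_bcontfun x t0) \<le>
        cmod (apply_bcontfun (x - y k) (t k)) + cmod (apply_bcontfun x (t k) - apply_bcontfun x t0)"
      using norm_triangle_ineq4 by metis
    moreover have "cmod ((1 + of_real (r n)) * apply_bcontfun x t0) = 1 + r n"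
    proof -
      have "cmod (of_real (1 + r n)) = 1 + r n" using r01 by (simp only: norm_of_real)
      then show ?thesis using t0 by (simp add: norm_mult)
    qed
    moreover have "cmod (apply_bcontfun x (t k) - apply_bcontfun x t0) < \<epsilon> / 2" using y(3)[of k] by simp
    ultimately show ?thesis using norm_bounded[of "x - y k" "t k"] n(2) by linarith
  qed
  ultimately show "\<exists>y\<in>W. 2 - \<epsilon> \<le> norm (x - y)" by blast
qed


text \<open>Choose \<open>x\<close> in the ball where the norm of \<open>P x\<close> exceeds
  \<open>c\<close>, a point \<open>t\<close> of \<open>shilov\<close> where \<open>P x\<close>
  attains its norm, and the phase \<omega> there. On the line from \<open>x\<close> towards 0 the
  value at \<open>t\<close> is a polynomial in the parameter, so by continuity a slightly shrunk
  \<open>x\<close> of norm below 1 will do.\<close>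

lemma polynomial_value_near_norm:
  assumes P: "polynomial_on A P" and c: "c < ball_norm A P"
  obtains s t \<omega> where "s \<in> A" "norm s < 1" "t \<in> shilov" "cmod \<omega> = 1"
    "c < Re (cnj \<omega> * apply_bcontfun (P s) t)"
proof -
  obtain x where x: "x \<in> unit_ball A" "c < norm (P x)"
  proof -
    obtain B where "\<And>z. z \<in> A \<Longrightarrow> norm z \<le> 1 \<Longrightarrow> norm (P z) \<le> B"
      using polynomial_on_bounded[OF P] by blast
    then have "bdd_above ((\<lambda>z. norm (P z)) ` unit_ball A)"
      by (intro bdd_aboveI2[of _ _ B]) (auto simp: unit_ball_def)
    then show thesis
      using c that zero_in_unit_ball[OF subspace] unfolding ball_norm_def
      by (subst (asm) less_cSUP_iff) auto
  qed
  have xA: "x \<in> A" "norm x \<le> 1" using x by (auto simp: unit_ball_def)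
  obtain t where t: "t \<in> shilov" "cmod (apply_bcontfun (P x) t) = norm (P x)"
    using is_boundary_shilov polynomial_on_maps[OF P subspace xA(1)] unfolding is_boundary_def by metis
  obtain \<omega> where \<omega>: "cmod \<omega> = 1" "cnj \<omega> * apply_bcontfun (P x) t = norm (P x)"
  proof (cases "apply_bcontfun (P x) t = 0")
    case True
    then show thesis using that[of 1] t by simp
  next
    case False
    let ?z = "apply_bcontfun (P x) t"
    have "cnj (sgn ?z) * ?z = cmod ?z"
      using False by (simp add: sgn_eq complex_norm_square[symmetric] mult.commute power2_eq_square)
    then show thesis using that[of "sgn ?z"] t False by (simp add: norm_sgn)
  qed
  obtain a d where a: "\<And>l. apply_bcontfun (P (x + l *\<^sub>C (- x))) t = (\<Sum>i\<le>d. a i * l ^ i)"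
    using polynomial_on_eval[OF P subspace, of t] xA uminus_mem unfolding scalar_polynomial_on_def by blast
  let ?f = "\<lambda>n. Re (cnj \<omega> * (\<Sum>i\<le>d. a i * of_real (inverse (real (Suc n))) ^ i))"
  have "?f \<longlonglongrightarrow> Re (cnj \<omega> * (\<Sum>i\<le>d. a i * of_real 0 ^ i))"
    by (intro tendsto_intros LIMSEQ_inverse_real_of_nat)
  moreover have "c < Re (cnj \<omega> * (\<Sum>i\<le>d. a i * of_real 0 ^ i))"
    using a[of 0] \<omega>(2) x(2) by simp
  ultimately have "\<forall>\<^sub>F n in sequentially. c < ?f n" by (rule order_tendstoD)
  then obtain n where n: "c < ?f n" by (auto simp: eventually_sequentially)
  define r where "r = inverse (real (Suc n))"
  have r: "0 < r" "r \<le> 1" by (simp_all add: r_def inverse_le_1_iff)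
  let ?s = "x + of_real r *\<^sub>C (- x)"
  show thesis
  proof (rule that)
    show "?s \<in> A" using xA by (intro add_mem scaleC_mem uminus_mem)
    have "?s = of_real (1 - r) *\<^sub>C x"
      by (simp add: complex_vector.scale_left_diff_distrib scaleC_one)
    then have "norm ?s = (1 - r) * norm x" using r by (simp only: norm_scaleC norm_of_real)
    also have "\<dots> \<le> (1 - r) * 1" using r xA by (intro mult_left_mono) auto
    finally show "norm ?s < 1" using r by simp
    show "c < Re (cnj \<omega> * apply_bcontfun (P ?s) t)" using n unfolding a r_def .
  qed (fact t \<omega>)+
qed

text \<open>
  Starting from a point where \<open>P\<close> almost attains its norm, spikes of height close to \<open>\<omega>\<close> are added
  one at a time. They barely change the value of \<open>P\<close> at the fixed point \<open>t0\<close>, hence \<open>P\<close> stays large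
  near \<open>t0\<close>, where the next spike is placed; but if the equation failed, then \<open>P\<close> would have to be
  small at the spikes already present.
\<close>

lemma polynomial_daugavet_lower_bound:
  assumes P: "polynomial_on A P" and wc: "weakly_compact_on A P"
  shows "1 + ball_norm A P \<le> ball_norm A (\<lambda>z. z + P z)"
proof (rule ccontr)
  define p where "p = ball_norm A P"
  define N where "N = ball_norm A (\<lambda>z. z + P z)"
  assume less: "\<not> 1 + ball_norm A P \<le> ball_norm A (\<lambda>z. z + P z)"
  \<comment> \<open>The amount by which the equation would fail.\<close>
  define \<gamma> where "\<gamma> = 1 + p - N"
  have \<gamma>: "0 < \<gamma>" using less by (simp add: \<gamma>_def p_def N_def)
  \<comment> \<open>Placed above \<open>p - 3 * \<gamma> / 4\<close>, the bound that the iterated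
    limits will impose on \<open>c\<close>.\<close>
  define c where "c = p - \<gamma> / 2"
  have "c < ball_norm A P" using \<gamma> by (simp add: c_def p_def)
  then obtain s0 t0 \<omega> where s0: "s0 \<in> A" "norm s0 < 1" and t0: "t0 \<in> shilov" and \<omega>: "cmod \<omega> = 1"
    and c0: "c < Re (cnj \<omega> * apply_bcontfun (P s0) t0)"
    using polynomial_value_near_norm[OF P] by metis
  \<comment> \<open>\<omega> is moved into the open disc by less than \<gamma> / 4; the minimum with
    1/2 keeps the factor positive.\<close>
  define b where "b = of_real (1 - min (\<gamma> / 8) (1 / 2)) * \<omega>"
  have b: "cmod b < 1" "cmod (b - \<omega>) < \<gamma> / 4"
  proof -
    have "cmod b = \<bar>1 - min (\<gamma> / 8) (1 / 2)\<bar>" unfolding b_def norm_mult \<omega> norm_of_real by simp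
    then show "cmod b < 1" using \<gamma> by (simp add: min_def)
    have "b - \<omega> = of_real (- min (\<gamma> / 8) (1 / 2)) * \<omega>" by (simp add: b_def algebra_simps)
    then have "cmod (b - \<omega>) = \<bar>- min (\<gamma> / 8) (1 / 2)\<bar>" by (simp only: norm_mult \<omega> norm_of_real mult_1_right)
    then show "cmod (b - \<omega>) < \<gamma> / 4" using \<gamma> by (simp add: min_def)
  qed
  define large where "large s = {t. c < Re (cnj \<omega> * apply_bcontfun (P s) t)}" for s
  have open_large: "open (large s)" for s
    unfolding large_def by (intro open_Collect_less continuous_intros continuous_on_apply_bcontfun)
  \<comment> \<open>A state consists of the current function \<open>s\<close>, the finite set
    \<open>F\<close> of spikes, where \<open>s\<close> is close to \<omega>, and a neighbourhood
    \<open>V\<close> of \<open>t0\<close> inside \<open>large s\<close>. New spikes are taken from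
    \<open>V\<close>, which only shrinks, so they lie in \<open>large\<close> of the current and all
    earlier functions.\<close>
  define I where "I X \<longleftrightarrow> (case X of (s, F, V) \<Rightarrow> s \<in> A \<and> norm s < 1 \<and> finite F \<and> F \<subseteq> shilov \<and>
    (\<forall>q\<in>F. cmod (apply_bcontfun s q - \<omega>) < \<gamma> / 4) \<and> open V \<and> t0 \<in> V \<and> V \<subseteq> large s)" for X
  define R where "R X Y \<longleftrightarrow> (case X of (s, F, V) \<Rightarrow> case Y of (s', F', V') \<Rightarrow>
    (\<exists>t\<in>V. F' = insert t F) \<and> V' \<subseteq> V)" for X Y :: "('a \<Rightarrow>\<^sub>C complex) \<times> 'a set \<times> 'a set"
  have "\<exists>X. \<forall>n. I (X n) \<and> R (X n) (X (Suc n))"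
  proof (rule dependent_nat_choice)
    show "\<exists>X. I X"
      using s0 c0 open_large by (intro exI[of _ "(s0, {}, large s0)"]) (simp add: I_def large_def)
  next
    fix X n assume "I X"
    obtain s F V where X: "X = (s, F, V)" by (metis prod_cases3)
    have s: "s \<in> A" "norm s < 1" and F: "finite F" "F \<subseteq> shilov"
      and sF: "\<And>q. q \<in> F \<Longrightarrow> cmod (apply_bcontfun s q - \<omega>) < \<gamma> / 4"
      and V: "open V" "t0 \<in> V" "V \<subseteq> large s" using \<open>I X\<close> by (auto simp: X I_def)
    \<comment> \<open>The slack in finitely many strict inequalities; the element 1 covers the case
      of empty \<open>F\<close>.\<close>
    obtain d where d: "0 < d" "\<And>q. q \<in> F \<Longrightarrow> cmod (apply_bcontfun s q - \<omega>) + d \<le> \<gamma> / 4"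
    proof -
      let ?D = "insert 1 ((\<lambda>q. \<gamma> / 4 - cmod (apply_bcontfun s q - \<omega>)) ` F)"
      have fin: "finite ?D" using F by simp
      have "Min ?D \<in> ?D" using fin by (intro Min_in) auto
      then have "0 < Min ?D" using sF by fastforce
      moreover have "Min ?D \<le> \<gamma> / 4 - cmod (apply_bcontfun s q - \<omega>)" if "q \<in> F" for q
        using that fin by (intro Min_le) auto
      ultimately show thesis using that[of "Min ?D"] by (simp add: algebra_simps)
    qed
    have ne: "V \<inter> shilov \<noteq> {}" using V t0 by blast
    obtain y t where y: "\<And>k. y k \<in> A" "\<And>k. norm (y k) < 1" "\<And>k. t k \<in> V \<inter> shilov"
      "\<And>k. apply_bcontfun (y k) (t k) = b"
      "\<And>k q. q \<in> F \<Longrightarrow> cmod (apply_bcontfun (y k) q - apply_bcontfun s q) < d"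
      and lim: "\<And>\<Phi>. scalar_polynomial_on A \<Phi> \<Longrightarrow> (\<lambda>k. \<Phi> (y k)) \<longlonglongrightarrow> \<Phi> s"
      using spike_sequence[OF s b(1) V(1) ne F d(1)] by metis
    \<comment> \<open>The values at \<open>t0\<close> converge, so \<open>t0\<close> belongs to
      \<open>large (y k)\<close> for some \<open>k\<close>.\<close>
    have "(\<lambda>k. Re (cnj \<omega> * apply_bcontfun (P (y k)) t0)) \<longlonglongrightarrow> Re (cnj \<omega> * apply_bcontfun (P s) t0)"
      by (intro tendsto_intros lim polynomial_on_eval P subspace)
    moreover have "c < Re (cnj \<omega> * apply_bcontfun (P s) t0)" using V by (auto simp: large_def)
    ultimately have "\<forall>\<^sub>F k in sequentially. c < Re (cnj \<omega> * apply_bcontfun (P (y k)) t0)"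
      by (rule order_tendstoD)
    then obtain k where k: "c < Re (cnj \<omega> * apply_bcontfun (P (y k)) t0)"
      by (auto simp: eventually_sequentially)
    let ?Y = "(y k, insert (t k) F, V \<inter> large (y k))"
    have "cmod (apply_bcontfun (y k) q - \<omega>) < \<gamma> / 4" if "q \<in> insert (t k) F" for q
    proof (cases "q \<in> F")
      case True
      then show ?thesis
        using y(5)[OF True, of k] d(2)[OF True]
          norm_triangle_ineq[of "apply_bcontfun (y k) q - apply_bcontfun s q" "apply_bcontfun s q - \<omega>"] by simp
    next
      case False
      then show ?thesis using that y(4)[of k] b(2) by simp
    qed
    then have "I ?Y"
      using y(1,2,3)[of k] F V k open_large[of "y k"] unfolding I_def by (auto simp: large_def)
    moreover have "R X ?Y" using y(3)[of k] unfolding X R_def by auto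
    ultimately show "\<exists>Y. I Y \<and> R X Y" by blast
  qed
  then obtain X where X: "\<And>n. I (X n)" "\<And>n. R (X n) (X (Suc n))" by blast
  define s F V where "s n = fst (X n)" and "F n = fst (snd (X n))" and "V n = snd (snd (X n))" for n
  have Xn: "X n = (s n, F n, V n)" for n by (simp add: s_def F_def V_def)
  have I: "s n \<in> A" "norm (s n) < 1" "\<And>q. q \<in> F n \<Longrightarrow> cmod (apply_bcontfun (s n) q - \<omega>) < \<gamma> / 4"
    "V n \<subseteq> large (s n)" for n
    using X(1)[of n] unfolding Xn I_def by auto
  have "\<exists>t\<in>V n. F (Suc n) = insert t (F n)" and Vdec: "V (Suc n) \<subseteq> V n" for n
    using X(2)[of n] unfolding Xn R_def by auto
  then obtain t where t: "\<And>n. t n \<in> V n" "\<And>n. F (Suc n) = insert (t n) (F n)" by metis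
  have Vmono: "V n \<subseteq> V m" if "m \<le> n" for m n using that Vdec by (rule lift_Suc_antimono_le[rotated])
  have Fmono: "F m \<subseteq> F n" if "m \<le> n" for m n
    by (rule lift_Suc_mono_le[OF _ that]) (use t(2) in blast)
  have PA: "P f \<in> A" if "f \<in> A" for f by (rule polynomial_on_maps[OF P subspace that])
  obtain B where B: "\<And>z. z \<in> A \<Longrightarrow> norm z \<le> 1 \<Longrightarrow> norm (P z) \<le> B"
    using polynomial_on_bounded[OF P] by blast
  have sball: "s n \<in> unit_ball A" for n using I(1,2)[of n] by (simp add: unit_ball_def)
  have "c \<le> p - 3 * \<gamma> / 4"
  proof (rule weakly_compact_on_double_limit[OF wc PA sball])
    show "c \<le> Re (cnj \<omega> * apply_bcontfun (P (s j)) (t n))" if "j \<le> n" for j n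
      using t(1)[of n] Vmono[OF that] I(4)[of j] by (auto simp: large_def)
    \<comment> \<open>At an earlier spike \<open>s j\<close> contributes at least 1 - \<gamma> / 4
      to a real part that is at most N = 1 + p - \<gamma>; this leaves at most p - 3 \<gamma> / 4
      for \<open>P (s j)\<close>.\<close>
    show "Re (cnj \<omega> * apply_bcontfun (P (s j)) (t n)) \<le> p - 3 * \<gamma> / 4" if "n < j" for j n
    proof -
      have "t n \<in> F j" using t(2)[of n] Fmono[of "Suc n" j] that by auto
      then have close: "cmod (apply_bcontfun (s j) (t n) - \<omega>) < \<gamma> / 4" by (rule I(3))
      have "norm (z + P z) \<le> 1 + B" if "z \<in> unit_ball A" for z
        using norm_triangle_ineq[of z "P z"] B[of z] that by (simp add: unit_ball_def)
      then have "norm (s j + P (s j)) \<le> N"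
        unfolding N_def using sball[of j] by (rule norm_le_ball_norm)
      then have "cmod (apply_bcontfun (s j + P (s j)) (t n)) \<le> N"
        using norm_bounded order_trans by blast
      then have "Re (cnj \<omega> * apply_bcontfun (s j + P (s j)) (t n)) \<le> N"
        using complex_Re_le_cmod[of "cnj \<omega> * apply_bcontfun (s j + P (s j)) (t n)"] \<omega>
        by (simp only: norm_mult complex_mod_cnj mult_1_left)
      moreover have "Re (cnj \<omega> * apply_bcontfun (s j) (t n)) \<ge> 1 - \<gamma> / 4"
      proof -
        have "cnj \<omega> * \<omega> = 1" using \<omega> by (simp add: complex_norm_square[symmetric] mult.commute)
        then have "cnj \<omega> * apply_bcontfun (s j) (t n) = 1 + cnj \<omega> * (apply_bcontfun (s j) (t n) - \<omega>)"
          by (simp add: algebra_simps)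
        then show ?thesis
          using abs_Re_le_cmod[of "cnj \<omega> * (apply_bcontfun (s j) (t n) - \<omega>)"] close \<omega>
          by (simp add: norm_mult)
      qed
      ultimately show ?thesis
        unfolding plus_bcontfun.rep_eq distrib_left plus_complex.sel
        by (simp only: \<gamma>_def) argo
    qed
  qed
  then show False using \<gamma> by (simp add: c_def)
qed

lemma polynomial_daugavet_property: "polynomial_daugavet_property A"
  unfolding polynomial_daugavet_property_def
proof (intro allI impI, elim conjE)
  fix P assume P: "polynomial_on A P" and wc: "weakly_compact_on A P"
  obtain B where B: "\<And>z. z \<in> A \<Longrightarrow> norm z \<le> 1 \<Longrightarrow> norm (P z) \<le> B"
    using polynomial_on_bounded[OF P] by blast
  have "ball_norm A (\<lambda>z. z + P z) \<le> 1 + ball_norm A P"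
  proof (rule ball_norm_le[OF subspace])
    fix z assume z: "z \<in> unit_ball A"
    then have "norm (P z) \<le> ball_norm A P"
      using B by (intro norm_le_ball_norm[where c = B]) (auto simp: unit_ball_def)
    then show "norm (z + P z) \<le> 1 + ball_norm A P"
      using norm_triangle_ineq[of z "P z"] z by (simp add: unit_ball_def)
  qed
  then show "ball_norm A (\<lambda>z. z + P z) = 1 + ball_norm A P"
    using polynomial_daugavet_lower_bound[OF P wc] by simp
qed

end

theorem corollary4p16:
  fixes A :: "('k::t2_space \<Rightarrow>\<^sub>C complex) set" and \<Gamma> :: "'k set"
  assumes "compact (UNIV :: 'k set)"
    and "uniform_algebra A"
    and "\<Gamma> = shilov_boundary A"
  shows "(polynomial_daugavet_property A \<longleftrightarrow> daugavet_property A) \<and>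
    (daugavet_property A \<longleftrightarrow> DD2P A) \<and>
    (DD2P A \<longleftrightarrow> DLD2P A) \<and>
    (DLD2P A \<longleftrightarrow> property_D A) \<and>
    (property_D A \<longleftrightarrow> \<not> (\<exists>t. t isolated_in \<Gamma>))"
proof -
  interpret uniform_alg A using assms by unfold_locales
  have \<Gamma>: "\<Gamma> = shilov" using assms(3) shilov_boundary_eq by simp
  have perfect: "perfect_uniform_alg A" if "\<not> (\<exists>t. t isolated_in \<Gamma>)"
    using that unfolding \<Gamma> by unfold_locales blast
  \<comment> \<open>The implications close two cycles through \<open>property_D A\<close> and the
    condition on \<Gamma>: one passes through both Daugavet properties, the other through both
    diametral properties.\<close>
  have "polynomial_daugavet_property A \<Longrightarrow> daugavet_property A"
    using polynomial_daugavet_property_imp_daugavet_property[OF subspace dual_separates] .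
  moreover have "daugavet_property A \<Longrightarrow> property_D A"
    by (rule daugavet_property_imp_property_D[OF subspace])
  moreover have "DD2P A \<Longrightarrow> DLD2P A" by (rule DD2P_imp_DLD2P)
  moreover have "DLD2P A \<Longrightarrow> property_D A" by (rule DLD2P_imp_property_D[OF subspace])
  moreover have "property_D A \<Longrightarrow> \<not> (\<exists>t. t isolated_in \<Gamma>)"
    unfolding \<Gamma> using property_D_imp_not_isolated by blast
  moreover have "\<not> (\<exists>t. t isolated_in \<Gamma>) \<Longrightarrow> polynomial_daugavet_property A"
    using perfect_uniform_alg.polynomial_daugavet_property[OF perfect] .
  moreover have "\<not> (\<exists>t. t isolated_in \<Gamma>) \<Longrightarrow> DD2P A"
    using perfect_uniform_alg.DD2P[OF perfect] .
  ultimately show ?thesis by argo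
qed

end
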